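(* Let $W(D_5^{(1)})=\langle s_0,\dots,s_5\rangle$ be the group generated by the following transformations of $(x,y,z,w,t;\alpha_0,\dots,\alpha_5)$, where $\alpha_0+\alpha_1+2\alpha_2+2\alpha_3+\alpha_4+\alpha_5=1$: $$\begin{aligned} s_0&:\ \to \left(x+\tfrac{\alpha_0}{y+t},y,z,w,t;-\alpha_0,\alpha_1,\alpha_2+\alpha_0,\alpha_3,\alpha_4,\alpha_5\right),\\ s_1&:\ \to \left(x+\tfrac{\alpha_1}{y},y,z,w,t;\alpha_0,-\alpha_1,\alpha_2+\alpha_1,\alpha_3,\alpha_4,\alpha_5\right),\\ s_2&:\ \to \left(x,y-\tfrac{\alpha_2}{x-z},z,w+\tfrac{\alpha_2}{x-z},t;\alpha_0+\alpha_2,\alpha_1+\alpha_2,-\alpha_2,\alpha_3+\alpha_2,\alpha_4,\alpha_5\right),\\ s_3&:\ \to \left(x,y,z+\tfrac{\alpha_3}{w},w,t;\alpha_0,\alpha_1,\alpha_2+\alpha_3,-\alpha_3,\alpha_4+\alpha_3,\alpha_5+\alpha_3\right),\\ s_4&:\ \to \left(x,y,z,w-\tfrac{\alpha_4}{z-1},t;\alpha_0,\alpha_1,\alpha_2,\alpha_3+\alpha_4,-\alpha_4,\alpha_5\right),\\ s_5&:\ \to \left(x,y,z,w-\tfrac{\alpha_5}{z},t;\alpha_0,\alpha_1,\alpha_2,\alpha_3+\alpha_5,\alpha_4,-\alpha_5\right). \end{aligned}$$ For the degeneration process given by the change of parameters and variables $$\alpha_0=A_0-A_2-A_3+\tfrac12\varepsilon^{-2},\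 \alpha_1=A_1,\ \alpha_2=A_2,\ \alpha_3=A_3,\ \alpha_4=-\tfrac12\varepsilon^{-2},\ \alpha_5=A_4,$$ $$t=\tfrac12\varepsilon^{-2}(1+2\varepsilon T),\quad x=-\frac{\varepsilon X}{1-\varepsilon X},\quad y=-\varepsilon^{-1}(1-\varepsilon X)[Y-\varepsilon(A_1+XY)],$$ $$z=-\frac{\varepsilon Z}{1-\varepsilon Z},\quad w=-\varepsilon^{-1}(1-\varepsilon Z)[W-\varepsilon(A_3+ZW)],$$ one can choose a subgroup $W_{D_5^{(1)}\to A_4^{(1)}}$ of $W(D_5^{(1)})$ such that $W_{D_5^{(1)}\to A_4^{(1)}}$ converges to $W(A_4^{(1)})$ as $\varepsilon\to0$.
   Context: $W(A_4^{(1)})$ denotes the group generated by the following transformations $\sigma_0,\dots,\sigma_4$ of $(X,Y,Z,W,T;A_0,\dots,A_4)$ with $A_0+A_1+A_2+A_3+A_4=1$ (Bäcklund transformations of the system of type $A_4^{(1)}$); write $\varphi=X-2Y-2W+2T$: $$\begin{aligned} \sigma_0&:\ \to \left(X-\tfrac{2A_0}{\varphi},Y-\tfrac{A_0}{\varphi},Z-\tfrac{2A_0}{\varphi},W,T;-A_0,A_1+A_0,A_2,A_3,A_4+A_0\right),\\ \sigma_1&:\ \to \left(X+\tfrac{A_1}{Y},Y,Z,W,T;A_0+A_1,-A_1,A_2+A_1,A_3,A_4\right),\\ \sigma_2&:\ \to \left(X,Y-\tfrac{A_2}{X-Z},Z,W+\tfrac{A_2}{X-Z},T;A_0,A_1+A_2,-A_2,A_3+A_2,A_4\right),\\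 \sigma_3&:\ \to \left(X,Y,Z+\tfrac{A_3}{W},W,T;A_0,A_1,A_2+A_3,-A_3,A_4+A_3\right),\\ \sigma_4&:\ \to \left(X,Y,Z,W-\tfrac{A_4}{Z},T;A_0+A_4,A_1,A_2,A_3+A_4,-A_4\right). \end{aligned}$$ Via the change of variables, elements of $W(D_5^{(1)})$ act on $A_0,\dots,A_4,\varepsilon,T,X,Y,Z,W$; here $\varepsilon$ is treated as one of the quantities acted on, $\varepsilon^2=-1/(2\alpha_4)$, so the image of $\varepsilon$ is determined only up to sign and a choice of sign (branch, as a formal power series in $\varepsilon$) is made for each generator. "The subgroup converges to $W(A_4^{(1)})$" means that it is generated by elements $S_0,\dots,S_4$ whose induced actions on $A_0,\dots,A_4,X,Y,Z,W,T$ (for suitable choices of the signs of $S_i(\varepsilon)$) tend, as $\varepsilon\to0$, to the actions of $\sigma_0,\dots,\sigma_4$ respectively. Products are composed as substitutions: $(ss')(f)=s(s'(f))$ for functions $f$. *)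

theory Defs
  imports
    "HOL-Library.Poly_Mapping"
    "HOL-Computational_Algebra.Fraction_Field"
    "HOL-Computational_Algebra.Formal_Laurent_Series"
    "HOL-Algebra.Generated_Groups"
    "HOL-Algebra.Bij"
begin

section \<open>Rational functions and substitution\<close>

text \<open>
  Complex polynomials in the variables \<open>'v\<close> are finitely supported maps from monomials
  (exponent vectors) to coefficients; a linear order on \<open>'v\<close> is only needed for the type class
  instance saying that they form an integral domain.
\<close>

type_synonym 'v ratfun = "(('v \<Rightarrow>\<^sub>0 nat) \<Rightarrow>\<^sub>0 complex) fract"

definition rconst :: "complex \<Rightarrow> 'v::linorder ratfun" where
  "rconst a = Fraction_Field.Fract (Poly_Mapping.single 0 a) 1"

definition rvar :: "'v \<Rightarrow> 'v::linorder ratfun" where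
  "rvar v = Fraction_Field.Fract (Poly_Mapping.single (Poly_Mapping.single v 1) 1) 1"

definition poly_eval ::
  "(complex \<Rightarrow> 'b::field) \<Rightarrow> ('v \<Rightarrow> 'b) \<Rightarrow> (('v::linorder \<Rightarrow>\<^sub>0 nat) \<Rightarrow>\<^sub>0 complex) \<Rightarrow> 'b" where
  "poly_eval c g p = (\<Sum>m\<in>Poly_Mapping.keys p. c (Poly_Mapping.lookup p m) *
     (\<Prod>v\<in>Poly_Mapping.keys m. g v ^ Poly_Mapping.lookup m v))"

text \<open>
  The result of substituting \<open>g v\<close> for each variable \<open>v\<close>, the complex constants being mapped by the
  embedding \<open>c\<close>. The value does not depend on the chosen representative with non-vanishing
  denominator. If the elements \<open>g v\<close> are algebraically independent, as they are wherever this is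
  used below, every non-zero denominator is admissible and the substitution is a field
  homomorphism.
\<close>

definition ratfun_eval ::
  "(complex \<Rightarrow> 'b::field) \<Rightarrow> ('v \<Rightarrow> 'b) \<Rightarrow> 'v::linorder ratfun \<Rightarrow> 'b" where
  "ratfun_eval c g f = (THE r. \<exists>p q. f = Fraction_Field.Fract p q \<and> poly_eval c g q \<noteq> 0 \<and>
     r = poly_eval c g p / poly_eval c g q)"


section \<open>The group of type D\<close>

text \<open>The tuple \<open>(x, y, z, w, t; \<alpha>\<^sub>0, \<dots>, \<alpha>\<^sub>5)\<close>.\<close>

datatype 'a d5 = DPt 'a 'a 'a 'a 'a 'a 'a 'a 'a 'a 'a

fun normalized_d5 :: "'a::field d5 \<Rightarrow> bool" where
  "normalized_d5 (DPt x y z w t a0 a1 a2 a3 a4 a5) \<longleftrightarrow> a0 + a1 + 2*a2 + 2*a3 + a4 + a5 = 1"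

fun s0_map :: "'a::field d5 \<Rightarrow> 'a d5" where
  "s0_map (DPt x y z w t a0 a1 a2 a3 a4 a5) =
     DPt (x + a0/(y + t)) y z w t (-a0) a1 (a2 + a0) a3 a4 a5"

fun s1_map :: "'a::field d5 \<Rightarrow> 'a d5" where
  "s1_map (DPt x y z w t a0 a1 a2 a3 a4 a5) =
     DPt (x + a1/y) y z w t a0 (-a1) (a2 + a1) a3 a4 a5"

fun s2_map :: "'a::field d5 \<Rightarrow> 'a d5" where
  "s2_map (DPt x y z w t a0 a1 a2 a3 a4 a5) =
     DPt x (y - a2/(x - z)) z (w + a2/(x - z)) t (a0 + a2) (a1 + a2) (-a2) (a3 + a2) a4 a5"

fun s3_map :: "'a::field d5 \<Rightarrow> 'a d5" where
  "s3_map (DPt x y z w t a0 a1 a2 a3 a4 a5) =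
     DPt x y (z + a3/w) w t a0 a1 (a2 + a3) (-a3) (a4 + a3) (a5 + a3)"

fun s4_map :: "'a::field d5 \<Rightarrow> 'a d5" where
  "s4_map (DPt x y z w t a0 a1 a2 a3 a4 a5) =
     DPt x y z (w - a4/(z - 1)) t a0 a1 a2 (a3 + a4) (-a4) a5"

fun s5_map :: "'a::field d5 \<Rightarrow> 'a d5" where
  "s5_map (DPt x y z w t a0 a1 a2 a3 a4 a5) =
     DPt x y z (w - a5/z) t a0 a1 a2 (a3 + a5) a4 (-a5)"

lemma normalized_d5_maps:
  assumes "normalized_d5 P"
  shows "normalized_d5 (s0_map P)" "normalized_d5 (s1_map P)" "normalized_d5 (s2_map P)"
    "normalized_d5 (s3_map P)" "normalized_d5 (s4_map P)" "normalized_d5 (s5_map P)"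
  using assms by (cases P; simp add: algebra_simps)+

text \<open>
  The transformations act on the field of rational functions of \<open>x, y, z, w, t, \<alpha>\<^sub>1, \<dots>, \<alpha>\<^sub>5\<close>;
  the remaining parameter is \<open>\<alpha>\<^sub>0 = 1 - \<alpha>\<^sub>1 - 2\<alpha>\<^sub>2 - 2\<alpha>\<^sub>3 - \<alpha>\<^sub>4 - \<alpha>\<^sub>5\<close>.
\<close>

datatype dvar = Vx | Vy | Vz | Vw | Vt | Va1 | Va2 | Va3 | Va4 | Va5

fun dvar_index :: "dvar \<Rightarrow> nat" where
  "dvar_index Vx = 0" | "dvar_index Vy = 1" | "dvar_index Vz = 2" | "dvar_index Vw = 3"
| "dvar_index Vt = 4" | "dvar_index Va1 = 5" | "dvar_index Va2 = 6" | "dvar_index Va3 = 7"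
| "dvar_index Va4 = 8" | "dvar_index Va5 = 9"

instantiation dvar :: linorder
begin
definition less_eq_dvar :: "dvar \<Rightarrow> dvar \<Rightarrow> bool" where
  "u \<le> v \<longleftrightarrow> dvar_index u \<le> dvar_index v"
definition less_dvar :: "dvar \<Rightarrow> dvar \<Rightarrow> bool" where
  "u < v \<longleftrightarrow> dvar_index u < dvar_index v"
instance
proof
  fix u v :: dvar
  show "u \<le> v \<Longrightarrow> v \<le> u \<Longrightarrow> u = v"
    by (cases u; cases v; simp add: less_eq_dvar_def)
qed (auto simp: less_eq_dvar_def less_dvar_def)
end

type_synonym dfield = "dvar ratfun"

definition d5_generic :: "dfield d5" where
  "d5_generic = DPt (rvar Vx) (rvar Vy) (rvar Vz) (rvar Vw) (rvar Vt)
     (1 - rvar Va1 - 2 * rvar Va2 - 2 * rvar Va3 - rvar Va4 - rvar Va5)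
     (rvar Va1) (rvar Va2) (rvar Va3) (rvar Va4) (rvar Va5)"

lemma normalized_d5_generic: "normalized_d5 d5_generic"
  by (simp add: d5_generic_def)

text \<open>
  The values of the variables at a tuple; the entry \<open>\<alpha>\<^sub>0\<close> is dropped because it is determined by the
  others (all tuples below are normalized).
\<close>

fun d5_coord :: "'a d5 \<Rightarrow> dvar \<Rightarrow> 'a" where
  "d5_coord (DPt x y z w t a0 a1 a2 a3 a4 a5) = case_dvar x y z w t a1 a2 a3 a4 a5"

text \<open>
  The automorphism \<open>f \<mapsto> s(f)\<close> of the function field. Composition of these maps is the product
  \<open>(s s')(f) = s(s'(f))\<close>.
\<close>

definition d5_subst :: "(dfield d5 \<Rightarrow> dfield d5) \<Rightarrow> dfield \<Rightarrow> dfield" where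
  "d5_subst m = ratfun_eval rconst (d5_coord (m d5_generic))"

definition W_D5 :: "(dfield \<Rightarrow> dfield) monoid" where
  "W_D5 = (BijGroup UNIV)\<lparr>carrier := generate (BijGroup UNIV)
     {d5_subst s0_map, d5_subst s1_map, d5_subst s2_map,
      d5_subst s3_map, d5_subst s4_map, d5_subst s5_map}\<rparr>"


section \<open>The group of type A\<close>

text \<open>The tuple \<open>(X, Y, Z, W, T; A\<^sub>0, \<dots>, A\<^sub>4)\<close>.\<close>

datatype 'a a4 = APt 'a 'a 'a 'a 'a 'a 'a 'a 'a 'a

fun normalized_a4 :: "'a::field a4 \<Rightarrow> bool" where
  "normalized_a4 (APt X Y Z W T A0 A1 A2 A3 A4) \<longleftrightarrow> A0 + A1 + A2 + A3 + A4 = 1"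

fun sigma0_map :: "'a::field a4 \<Rightarrow> 'a a4" where
  "sigma0_map (APt X Y Z W T a0 a1 a2 a3 a4) =
     (let \<phi> = X - 2*Y - 2*W + 2*T in
      APt (X - 2*a0/\<phi>) (Y - a0/\<phi>) (Z - 2*a0/\<phi>) W T (-a0) (a1 + a0) a2 a3 (a4 + a0))"

fun sigma1_map :: "'a::field a4 \<Rightarrow> 'a a4" where
  "sigma1_map (APt X Y Z W T a0 a1 a2 a3 a4) =
     APt (X + a1/Y) Y Z W T (a0 + a1) (-a1) (a2 + a1) a3 a4"

fun sigma2_map :: "'a::field a4 \<Rightarrow> 'a a4" where
  "sigma2_map (APt X Y Z W T a0 a1 a2 a3 a4) =
     APt X (Y - a2/(X - Z)) Z (W + a2/(X - Z)) T a0 (a1 + a2) (-a2) (a3 + a2) a4"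

fun sigma3_map :: "'a::field a4 \<Rightarrow> 'a a4" where
  "sigma3_map (APt X Y Z W T a0 a1 a2 a3 a4) =
     APt X Y (Z + a3/W) W T a0 a1 (a2 + a3) (-a3) (a4 + a3)"

fun sigma4_map :: "'a::field a4 \<Rightarrow> 'a a4" where
  "sigma4_map (APt X Y Z W T a0 a1 a2 a3 a4) =
     APt X Y Z (W - a4/Z) T (a0 + a4) a1 a2 (a3 + a4) (-a4)"

lemma normalized_a4_maps:
  assumes "normalized_a4 Q"
  shows "normalized_a4 (sigma0_map Q)" "normalized_a4 (sigma1_map Q)"
    "normalized_a4 (sigma2_map Q)" "normalized_a4 (sigma3_map Q)" "normalized_a4 (sigma4_map Q)"
  using assms by (cases Q; simp add: Let_def algebra_simps)+

datatype avar = VX | VY | VZ | VW | VT | VA1 | VA2 | VA3 | VA4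

fun avar_index :: "avar \<Rightarrow> nat" where
  "avar_index VX = 0" | "avar_index VY = 1" | "avar_index VZ = 2" | "avar_index VW = 3"
| "avar_index VT = 4" | "avar_index VA1 = 5" | "avar_index VA2 = 6" | "avar_index VA3 = 7"
| "avar_index VA4 = 8"

instantiation avar :: linorder
begin
definition less_eq_avar :: "avar \<Rightarrow> avar \<Rightarrow> bool" where
  "u \<le> v \<longleftrightarrow> avar_index u \<le> avar_index v"
definition less_avar :: "avar \<Rightarrow> avar \<Rightarrow> bool" where
  "u < v \<longleftrightarrow> avar_index u < avar_index v"
instance
proof
  fix u v :: avar
  show "u \<le> v \<Longrightarrow> v \<le> u \<Longrightarrow> u = v"
    by (cases u; cases v; simp add: less_eq_avar_def)
qed (auto simp: less_eq_avar_def less_avar_def)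
end

type_synonym afield = "avar ratfun"

definition a4_generic :: "afield a4" where
  "a4_generic = APt (rvar VX) (rvar VY) (rvar VZ) (rvar VW) (rvar VT)
     (1 - rvar VA1 - rvar VA2 - rvar VA3 - rvar VA4)
     (rvar VA1) (rvar VA2) (rvar VA3) (rvar VA4)"

lemma normalized_a4_generic: "normalized_a4 a4_generic"
  by (simp add: a4_generic_def)

text \<open>As in the D case, \<open>A\<^sub>0\<close> is dropped.\<close>

fun a4_coord :: "'a a4 \<Rightarrow> avar \<Rightarrow> 'a" where
  "a4_coord (APt X Y Z W T a0 a1 a2 a3 a4) = case_avar X Y Z W T a1 a2 a3 a4"

definition a4_subst :: "(afield a4 \<Rightarrow> afield a4) \<Rightarrow> afield \<Rightarrow> afield" where
  "a4_subst m = ratfun_eval rconst (a4_coord (m a4_generic))"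

definition sigmas :: "(afield \<Rightarrow> afield) list" where
  "sigmas = [a4_subst sigma0_map, a4_subst sigma1_map, a4_subst sigma2_map,
     a4_subst sigma3_map, a4_subst sigma4_map]"

definition W_A4 :: "(afield \<Rightarrow> afield) monoid" where
  "W_A4 = (BijGroup UNIV)\<lparr>carrier := generate (BijGroup UNIV) (set sigmas)\<rparr>"


section \<open>The degeneration\<close>

text \<open>The change of parameters and variables, for arbitrary values of the new quantities.\<close>

fun change_vars :: "'a::field \<Rightarrow> 'a a4 \<Rightarrow> 'a d5" where
  "change_vars e (APt X Y Z W T A0 A1 A2 A3 A4) =
     DPt (- (e*X / (1 - e*X)))
        (- (1/e) * (1 - e*X) * (Y - e*(A1 + X*Y)))
        (- (e*Z / (1 - e*Z)))
        (- (1/e) * (1 - e*Z) * (W - e*(A3 + Z*W)))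
        (1/(2*e^2) * (1 + 2*e*T))
        (A0 - A2 - A3 + 1/(2*e^2)) A1 A2 A3 (- (1/(2*e^2))) A4"

lemma normalized_change_vars:
  assumes "normalized_a4 Q"
  shows "normalized_d5 (change_vars e Q)"
  using assms by (cases Q; simp add: algebra_simps)

text \<open>
  Formal Laurent series in \<open>\<epsilon>\<close> (that is, \<^term>\<open>fls_X\<close>) over the field of rational functions of
  \<open>X, Y, Z, W, T, A\<^sub>1, \<dots>, A\<^sub>4\<close>. The change of variables embeds the function field of type D into it.
\<close>

type_synonym aseries = "afield fls"

definition degeneration :: "dfield \<Rightarrow> aseries" where
  "degeneration = ratfun_eval (\<lambda>c. fls_const (rconst c))
     (d5_coord (change_vars fls_X (map_a4 fls_const a4_generic)))"

text \<open>
  \<open>E\<close> and \<open>Q\<close> are the images of \<open>\<epsilon>\<close> and of \<open>(X, Y, Z, W, T; A\<^sub>0, \<dots>, A\<^sub>4)\<close> under an action on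
  these quantities induced by \<open>S\<close>: the images of both sides of the change of variables agree.
  The equation for \<open>\<alpha>\<^sub>4\<close> says \<open>E\<^sup>2 = -1/(2 S(\<alpha>\<^sub>4))\<close>, so \<open>E\<close> is determined up to sign, and \<open>Q\<close> is
  determined by \<open>E\<close>.
\<close>

definition induced_action :: "(dfield \<Rightarrow> dfield) \<Rightarrow> aseries \<Rightarrow> aseries a4 \<Rightarrow> bool" where
  "induced_action S E Q \<longleftrightarrow>
     E \<noteq> 0 \<and> map_d5 (\<lambda>f. degeneration (S f)) d5_generic = change_vars E Q"

text \<open>\<open>h\<close> has no pole at \<open>\<epsilon> = 0\<close> and takes the value \<open>f\<close> there.\<close>

definition tends_to :: "'a::zero fls \<Rightarrow> 'a \<Rightarrow> bool" where
  "tends_to h f \<longleftrightarrow> (\<forall>n<0. fls_nth h n = 0) \<and> fls_nth h 0 = f"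

text \<open>
  \<open>G\<close> is generated by the listed transformations, and the subgroup \<open>H\<close> by elements whose induced
  actions, for suitable signs of the images of \<open>\<epsilon>\<close>, tend to the actions of these transformations
  on \<open>X, Y, Z, W, T, A\<^sub>0, \<dots>, A\<^sub>4\<close>.
\<close>

definition converges_to ::
  "(dfield \<Rightarrow> dfield) set \<Rightarrow> (afield \<Rightarrow> afield) monoid \<Rightarrow> (afield \<Rightarrow> afield) list \<Rightarrow> bool" where
  "converges_to H G gs \<longleftrightarrow>
     carrier G = generate G (set gs) \<and>
     (\<exists>S :: nat \<Rightarrow> dfield \<Rightarrow> dfield.
        H = generate W_D5 (S ` {..<length gs}) \<and>
        (\<forall>i<length gs. \<exists>E Q. induced_action (S i) E Q \<and>
           rel_a4 tends_to Q (map_a4 (gs ! i) a4_generic)))"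

end

theory Submission
  imports Defs
begin

text \<open>
Under the change of variables, \<open>s\<^sub>1, s\<^sub>2, s\<^sub>3, s\<^sub>5\<close> act on \<open>A\<^sub>1, A\<^sub>2, A\<^sub>3, A\<^sub>4\<close> like \<open>\<sigma>\<^sub>1, \<sigma>\<^sub>2, \<sigma>\<^sub>3, \<sigma>\<^sub>4\<close>, while the parameters
\<open>\<alpha>\<^sub>0\<close> and \<open>\<alpha>\<^sub>4\<close> of the two remaining generators have a pole at \<open>\<epsilon> = 0\<close>. These poles cancel in the root
\<open>\<alpha>\<^sub>0 + \<alpha>\<^sub>2 + \<alpha>\<^sub>3 + \<alpha>\<^sub>4 = A\<^sub>0\<close>, which together with \<open>\<alpha>\<^sub>1, \<alpha>\<^sub>2, \<alpha>\<^sub>3, \<alpha>\<^sub>5\<close> spans a diagram of type \<open>A\<^sub>4\<^sup>(\<^sup>1\<^sup>)\<close>.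
So the subgroup is generated by \<open>s\<^sub>1, s\<^sub>2, s\<^sub>3, s\<^sub>5\<close> and the reflection
\<open>s\<^sub>0 s\<^sub>4 s\<^sub>2 s\<^sub>3 s\<^sub>2 s\<^sub>4 s\<^sub>0\<close> in this root, which converges to \<open>\<sigma>\<^sub>0\<close>.

Two things have to be proved. The generators must really be automorphisms of the function
fields, so that they lie in a group of bijections. This follows from their being involutions: a
substitution that is inverse to itself cannot have algebraically dependent components
(locale \<open>involutive_substitution\<close>).

The limits must be computed. To leading order \<open>x, y, z, w\<close> are \<open>-\<epsilon>X, -Y/\<epsilon>, -\<epsilon>Z, -W/\<epsilon>\<close>. Once these powers of
\<open>\<epsilon>\<close> are split off, all quantities are regular at \<open>\<epsilon> = 0\<close>, the image of \<open>\<epsilon>\<close> is \<open>\<epsilon>\<close> times a unit (the square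
root of a power series with constant term \<open>1\<close>), and the limit of the induced action is read off from the
limits of the rescaled variables (\<open>induced_action_limit\<close>). This is immediate for \<open>s\<^sub>1, s\<^sub>2, s\<^sub>3, s\<^sub>5\<close>
(\<open>limits_simple_reflections\<close>). For the word of length seven the poles of the intermediate tuples have to be
cancelled (\<open>reflection_word\<close>); the denominator \<open>\<phi>\<close> of \<open>\<sigma>\<^sub>0\<close> arises as the leading coefficient of
\<open>w\<close> at the letter \<open>s\<^sub>3\<close> (\<open>limit_reflection\<close>).
\<close>

section \<open>Places: partially defined field homomorphisms\<close>

text \<open>
The proof applies a rational transformation \<open>m\<close> to tuples in several fields: rational functions, their
values after a substitution, Laurent series and the values of these at \<open>\<epsilon> = 0\<close>. Each passage from one
field to another is only partially defined, but on its domain it respects the field operations as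
long as no denominator becomes zero. Such a relation is called a place here. It transports \<open>m\<close>
whenever the denominators of \<open>m\<close> are non-zero \<^emph>\<open>in the target\<close>, so one argument serves substitutions
and limits alike.
\<close>

locale place =
  fixes R :: "'a::field \<Rightarrow> 'b::field \<Rightarrow> bool"
  assumes one: "R 1 1"
    and add: "R a a' \<Longrightarrow> R b b' \<Longrightarrow> R (a + b) (a' + b')"
    and uminus: "R a a' \<Longrightarrow> R (- a) (- a')"
    and mult: "R a a' \<Longrightarrow> R b b' \<Longrightarrow> R (a * b) (a' * b')"
    and inverse: "R a a' \<Longrightarrow> a' \<noteq> 0 \<Longrightarrow> R (inverse a) (inverse a')"
    and functional: "R a a' \<Longrightarrow> R a a'' \<Longrightarrow> a' = a''"
begin

lemma diff: "R a a' \<Longrightarrow> R b b' \<Longrightarrow> R (a - b) (a' - b')"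
  using add[of a a' "- b" "- b'"] uminus by simp

lemma zero: "R 0 0"
  using diff[OF one one] by simp

lemma divide: "R a a' \<Longrightarrow> R b b' \<Longrightarrow> b' \<noteq> 0 \<Longrightarrow> R (a / b) (a' / b')"
  by (simp add: field_class.field_divide_inverse mult inverse)

lemma power: "R a a' \<Longrightarrow> R (a ^ n) (a' ^ n)"
  by (induction n) (auto intro: one mult)

lemma numeral: "R (numeral k) (numeral k)"
  by (induction k) (auto simp only: numeral.simps intro: one add)

lemma sum: "(\<And>i. i \<in> I \<Longrightarrow> R (f i) (f' i)) \<Longrightarrow> R (sum f I) (sum f' I)"
  by (induction I rule: infinite_finite_induct) (auto intro: zero add)

lemma prod: "(\<And>i. i \<in> I \<Longrightarrow> R (f i) (f' i)) \<Longrightarrow> R (prod f I) (prod f' I)"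
  by (induction I rule: infinite_finite_induct) (auto intro: one mult)

lemma nonzero: "R a a' \<Longrightarrow> a' \<noteq> 0 \<Longrightarrow> a \<noteq> 0"
  using functional zero by blast

lemmas arith = one zero add uminus diff mult divide power numeral

end

text \<open>
A totally defined homomorphism respects even division by zero, since \<open>inverse 0 = 0\<close>. This is why the
automorphisms of the function field can be moved past any transformation.
\<close>

locale field_hom =
  fixes h :: "'a::field \<Rightarrow> 'b::field"
  assumes one: "h 1 = 1"
    and add: "h (a + b) = h a + h b"
    and mult: "h (a * b) = h a * h b"
begin

lemma zero: "h 0 = 0"
  using add[of 0 0] by (simp only: add_0_left add_cancel_right_right)

lemma uminus: "h (- a) = - h a"
  using add[of a "- a"] by (simp add: zero eq_neg_iff_add_eq_0 add.commute)

lemma diff: "h (a - b) = h a - h b"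
  using add[of a "- b"] by (simp add: uminus)

lemma inverse: "h (inverse a) = inverse (h a)"
proof (cases "a = 0")
  case False
  then have "h a * h (inverse a) = 1"
    by (simp add: one flip: mult)
  then show ?thesis
    by (metis inverse_unique)
qed (simp add: zero)

lemma divide: "h (a / b) = h a / h b"
  by (simp add: field_class.field_divide_inverse mult inverse)

lemmas arith = one add uminus diff divide

end

section \<open>Evaluation of polynomials\<close>

lemma poly_mapping_additive_induct [case_names zero single add]:
  assumes "P 0" "\<And>m a. P (Poly_Mapping.single m a)" "\<And>p q. P p \<Longrightarrow> P q \<Longrightarrow> P (p + q)"
  shows "P (p :: 'a \<Rightarrow>\<^sub>0 'b::comm_monoid_add)"
proof (induction p rule: update_induct)
  case const
  show ?case by (fact assms(1))
next
  case (update f a b)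
  have "Poly_Mapping.update a b f = f + Poly_Mapping.single a b"
    using update(1)
    by (intro poly_mapping_eqI)
      (auto simp: lookup_update lookup_add lookup_single when_def in_keys_iff)
  then show ?case
    using assms(2,3) update by simp
qed

definition monom_eval :: "('v \<Rightarrow> 'b::field) \<Rightarrow> ('v \<Rightarrow>\<^sub>0 nat) \<Rightarrow> 'b" where
  "monom_eval g m = (\<Prod>v\<in>Poly_Mapping.keys m. g v ^ Poly_Mapping.lookup m v)"

lemma monom_eval_superset:
  assumes "finite V" "Poly_Mapping.keys m \<subseteq> V"
  shows "monom_eval g m = (\<Prod>v\<in>V. g v ^ Poly_Mapping.lookup m v)"
  unfolding monom_eval_def using assms
  by (intro prod.mono_neutral_left) (auto simp: in_keys_iff)

lemma monom_eval_add: "monom_eval g (m + n) = monom_eval g m * monom_eval g n"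
proof -
  let ?V = "Poly_Mapping.keys m \<union> Poly_Mapping.keys n"
  have "Poly_Mapping.keys (m + n) \<subseteq> ?V"
    by (rule Poly_Mapping.keys_add)
  then show ?thesis
    by (simp add: monom_eval_superset[where V = ?V] lookup_add power_add prod.distrib)
qed

lemma monom_eval_0 [simp]: "monom_eval g 0 = 1"
  by (simp add: monom_eval_def)

lemma monom_eval_single [simp]: "monom_eval g (Poly_Mapping.single v (Suc 0)) = g v"
  by (simp add: monom_eval_def)

text \<open>
Embeddings of the complex constants; for these, \<^const>\<open>poly_eval\<close> is a ring homomorphism.
\<close>

locale coeff_hom =
  fixes c :: "complex \<Rightarrow> 'b::field"
  assumes one: "c 1 = 1"
    and add: "c (a + b) = c a + c b"
    and mult: "c (a * b) = c a * c b"
begin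

lemma zero: "c 0 = 0"
  using add[of 0 0] by (simp only: add_0_left add_cancel_right_right)

lemma poly_eval_superset:
  assumes "finite M" "Poly_Mapping.keys p \<subseteq> M"
  shows "poly_eval c g p = (\<Sum>m\<in>M. c (Poly_Mapping.lookup p m) * monom_eval g m)"
  unfolding poly_eval_def monom_eval_def[symmetric] using assms
  by (intro sum.mono_neutral_left) (auto simp: in_keys_iff zero)

lemma poly_eval_single: "poly_eval c g (Poly_Mapping.single m a) = c a * monom_eval g m"
  by (simp add: poly_eval_superset[where M = "{m}"])

lemma poly_eval_0: "poly_eval c g 0 = 0"
  by (simp add: poly_eval_def)

lemma poly_eval_1: "poly_eval c g 1 = 1"
  using poly_eval_single[of g 0 1] by (simp add: one)

lemma poly_eval_add: "poly_eval c g (p + q) = poly_eval c g p + poly_eval c g q"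
proof -
  let ?M = "Poly_Mapping.keys p \<union> Poly_Mapping.keys q"
  have "Poly_Mapping.keys (p + q) \<subseteq> ?M"
    by (rule Poly_Mapping.keys_add)
  then show ?thesis
    by (simp add: poly_eval_superset[where M = ?M] lookup_add add distrib_right sum.distrib)
qed

lemma poly_eval_uminus: "poly_eval c g (- p) = - poly_eval c g p"
  using poly_eval_add[of g p "- p"] by (simp add: poly_eval_0 eq_neg_iff_add_eq_0 add.commute)

lemma poly_eval_mult: "poly_eval c g (p * q) = poly_eval c g p * poly_eval c g q"
proof (induction p rule: poly_mapping_additive_induct)
  case (single m a)
  show ?case
  proof (induction q rule: poly_mapping_additive_induct)
    case (single n b)
    show ?case
      by (simp add: mult_single poly_eval_single mult monom_eval_add)
  qed (simp_all add: poly_eval_0 poly_eval_add distrib_left)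
qed (simp_all add: poly_eval_0 poly_eval_add distrib_right)

end

section \<open>Substitution into rational functions\<close>

text \<open>
The relation underlying \<^const>\<open>ratfun_eval\<close>. It does not presuppose that the \<open>g v\<close> are algebraically
independent, and can therefore be used to prove that they are.
\<close>

definition evaluates_to ::
  "(complex \<Rightarrow> 'b::field) \<Rightarrow> ('v \<Rightarrow> 'b) \<Rightarrow> 'v::linorder ratfun \<Rightarrow> 'b \<Rightarrow> bool" where
  "evaluates_to c g f r \<longleftrightarrow> (\<exists>p q. f = Fraction_Field.Fract p q \<and> poly_eval c g q \<noteq> 0 \<and>
     r = poly_eval c g p / poly_eval c g q)"

context coeff_hom
begin

lemma evaluates_toE:
  assumes "evaluates_to c g f r"
  obtains p q where "f = Fraction_Field.Fract p q" "q \<noteq> 0" "poly_eval c g q \<noteq> 0"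
    "r = poly_eval c g p / poly_eval c g q"
proof -
  obtain p q where *: "f = Fraction_Field.Fract p q" "poly_eval c g q \<noteq> 0"
    "r = poly_eval c g p / poly_eval c g q"
    using assms by (auto simp: evaluates_to_def)
  with poly_eval_0 have "q \<noteq> 0" by auto
  with * show ?thesis using that by blast
qed

lemma evaluates_to_place: "place (evaluates_to c (g :: 'v::linorder \<Rightarrow> 'b))"
proof
  show "evaluates_to c g 1 1"
    unfolding evaluates_to_def
    by (rule exI[of _ 1], rule exI[of _ 1]) (simp add: poly_eval_1 One_fract_def)
next
  fix a b :: "'v ratfun" and a' b'
  assume a: "evaluates_to c g a a'" and b: "evaluates_to c g b b'"
  from a obtain p q where pq: "a = Fraction_Field.Fract p q" "q \<noteq> 0" "poly_eval c g q \<noteq> 0"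
    "a' = poly_eval c g p / poly_eval c g q" by (rule evaluates_toE)
  from b obtain u v where uv: "b = Fraction_Field.Fract u v" "v \<noteq> 0" "poly_eval c g v \<noteq> 0"
    "b' = poly_eval c g u / poly_eval c g v" by (rule evaluates_toE)
  show "evaluates_to c g (a + b) (a' + b')"
    unfolding evaluates_to_def
    by (rule exI[of _ "p * v + u * q"], rule exI[of _ "q * v"])
      (use pq uv in \<open>simp add: poly_eval_add poly_eval_mult add_frac_eq mult.commute\<close>)
  show "evaluates_to c g (a * b) (a' * b')"
    unfolding evaluates_to_def
    by (rule exI[of _ "p * u"], rule exI[of _ "q * v"])
      (use pq uv in \<open>simp add: poly_eval_mult\<close>)
next
  fix a :: "'v ratfun" and a'
  assume a: "evaluates_to c g a a'"
  from a obtain p q where pq: "a = Fraction_Field.Fract p q" "q \<noteq> 0" "poly_eval c g q \<noteq> 0"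
    "a' = poly_eval c g p / poly_eval c g q" by (rule evaluates_toE)
  show "evaluates_to c g (- a) (- a')"
    unfolding evaluates_to_def
    by (rule exI[of _ "- p"], rule exI[of _ q]) (use pq in \<open>simp add: poly_eval_uminus\<close>)
  show "evaluates_to c g (inverse a) (inverse a')" if "a' \<noteq> 0"
    unfolding evaluates_to_def
    by (rule exI[of _ q], rule exI[of _ p]) (use pq that in \<open>auto simp: poly_eval_0\<close>)
  fix a''
  assume "evaluates_to c g a a''"
  then obtain u v where uv: "a = Fraction_Field.Fract u v" "v \<noteq> 0" "poly_eval c g v \<noteq> 0"
    "a'' = poly_eval c g u / poly_eval c g v" by (rule evaluates_toE)
  from pq uv have "p * v = u * q"
    by (simp add: eq_fract)
  then have "poly_eval c g p * poly_eval c g v = poly_eval c g u * poly_eval c g q"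
    by (simp flip: poly_eval_mult)
  with pq uv show "a' = a''"
    by (simp add: frac_eq_eq)
qed

lemma evaluates_to_rconst: "evaluates_to c g (rconst a) (c a)"
  unfolding evaluates_to_def rconst_def
  by (rule exI[of _ "Poly_Mapping.single 0 a"], rule exI[of _ 1])
    (simp add: poly_eval_single poly_eval_1)

lemma evaluates_to_rvar: "evaluates_to c g (rvar v) (g v)"
  unfolding evaluates_to_def rvar_def
  by (rule exI[of _ "Poly_Mapping.single (Poly_Mapping.single v 1) 1"], rule exI[of _ 1])
    (simp add: poly_eval_single poly_eval_1 one)

lemma ratfun_eval_eqI:
  assumes "evaluates_to c g f r"
  shows "ratfun_eval c g f = r"
proof -
  interpret place "evaluates_to c g" by (rule evaluates_to_place)
  show ?thesis
    unfolding ratfun_eval_def evaluates_to_def[symmetric]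
    using assms functional by blast
qed

end

lemma coeff_hom_id: "coeff_hom (\<lambda>a. a)"
  by standard simp_all

lemma coeff_hom_rconst: "coeff_hom rconst"
  by standard (simp_all add: rconst_def One_fract_def single_add mult_single)

lemma coeff_hom_fls_const_rconst: "coeff_hom (\<lambda>a. fls_const (rconst a))"
proof -
  interpret coeff_hom rconst by (rule coeff_hom_rconst)
  show ?thesis
    by standard (simp_all add: one add mult fls_plus_const)
qed

interpretation rconst: coeff_hom rconst
  by (rule coeff_hom_rconst)

lemma poly_eval_rvar: "poly_eval rconst rvar p = Fraction_Field.Fract p 1"
proof (induction p rule: poly_mapping_additive_induct)
  case zero
  show ?case by (simp add: rconst.poly_eval_0 Zero_fract_def)
next
  case (single m a)
  have *: "monom_eval rvar m = Fraction_Field.Fract (Poly_Mapping.single m 1) 1"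
  proof (induction m rule: poly_mapping_additive_induct)
    case (single v n)
    show ?case
    proof (induction n)
      case (Suc n)
      have "Poly_Mapping.single v (Suc n) = Poly_Mapping.single v (Suc 0) + Poly_Mapping.single v n"
        by (simp flip: single_add)
      then show ?case
        by (simp only: monom_eval_add Suc monom_eval_single)
          (simp add: rvar_def mult_single)
    qed (simp add: One_fract_def)
  qed (simp_all add: monom_eval_add mult_single One_fract_def)
  show ?case
    unfolding rconst.poly_eval_single * by (simp add: rconst_def mult_single)
next
  case (add p q)
  then show ?case by (simp add: rconst.poly_eval_add)
qed

text \<open>
If substituting \<open>g\<close> into the functions \<open>g v\<close> gives back the variables, then the \<open>g v\<close> are
algebraically independent: applying the substitution once more to a relation \<open>p(g) = 0\<close> is permitted
and yields \<open>p = 0\<close>. Hence no non-zero denominator is ever lost, and the substitution is an involutive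
automorphism of the whole function field. This is how the generators of both groups are recognised as
bijections.
\<close>

locale involutive_substitution =
  fixes g :: "'v::linorder \<Rightarrow> 'v ratfun"
  assumes involutive: "evaluates_to rconst g (g v) (rvar v)"
begin

sublocale place "evaluates_to rconst g"
  by (rule rconst.evaluates_to_place)

lemma evaluates_to_poly_eval:
  "evaluates_to rconst g (poly_eval rconst g p) (Fraction_Field.Fract p 1)"
  unfolding poly_eval_rvar[symmetric] unfolding poly_eval_def
  by (intro sum mult prod power rconst.evaluates_to_rconst involutive)

lemma algebraically_independent:
  assumes "poly_eval rconst g p = 0"
  shows "p = 0"
proof -
  have "Fraction_Field.Fract p 1 = 0"
    using functional zero evaluates_to_poly_eval[of p] assms by metis
  then show ?thesis by (simp add: Zero_fract_def eq_fract)
qed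

lemma evaluates_to_ratfun_eval: "evaluates_to rconst g f (ratfun_eval rconst g f)"
proof -
  obtain p q where "f = Fraction_Field.Fract p q" "q \<noteq> 0"
    by (cases f) auto
  then have "evaluates_to rconst g f (poly_eval rconst g p / poly_eval rconst g q)"
    using algebraically_independent unfolding evaluates_to_def by blast
  then show ?thesis
    by (simp add: rconst.ratfun_eval_eqI)
qed

lemma field_hom_ratfun_eval: "field_hom (ratfun_eval rconst g)"
  by standard
    (intro rconst.ratfun_eval_eqI one add mult evaluates_to_ratfun_eval)+

lemma ratfun_eval_involution: "ratfun_eval rconst g (ratfun_eval rconst g f) = f"
proof -
  obtain p q where f: "f = Fraction_Field.Fract p q" and "q \<noteq> 0"
    by (cases f) auto
  then have nz: "poly_eval rconst g q \<noteq> 0" "Fraction_Field.Fract q 1 \<noteq> 0"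
    using algebraically_independent by (auto simp: Zero_fract_def eq_fract)
  then have "evaluates_to rconst g f (poly_eval rconst g p / poly_eval rconst g q)"
    using f unfolding evaluates_to_def by blast
  moreover have "evaluates_to rconst g (poly_eval rconst g p / poly_eval rconst g q)
      (Fraction_Field.Fract p 1 / Fraction_Field.Fract q 1)"
    by (intro divide evaluates_to_poly_eval nz)
  ultimately show ?thesis
    by (simp add: rconst.ratfun_eval_eqI f)
qed

lemma in_Bij: "ratfun_eval rconst g \<in> Bij UNIV"
  unfolding Bij_def
  by (auto intro!: bij_betw_byWitness[where f' = "ratfun_eval rconst g"] simp: ratfun_eval_involution)

end

section \<open>Limits of Laurent series\<close>

text \<open>
Laurent series without pole at \<open>\<epsilon> = 0\<close> are the formal power series, and a power series with non-zero
constant term is a unit. So taking the value at \<open>\<epsilon> = 0\<close> is a place.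
\<close>

lemma tends_to_iff_fps: "tends_to h f \<longleftrightarrow> (\<exists>p. h = fps_to_fls p \<and> fps_nth p 0 = f)"
proof
  assume "tends_to h f"
  then show "\<exists>p. h = fps_to_fls p \<and> fps_nth p 0 = f"
    by (intro exI[of _ "fls_regpart h"])
      (auto simp: tends_to_def intro!: fls_eqI)
qed (auto simp: tends_to_def)

lemma tends_to_place: "place (tends_to :: 'a::field fls \<Rightarrow> 'a \<Rightarrow> bool)"
proof
  show "tends_to (1 :: 'a fls) 1"
    by (auto simp: tends_to_def)
next
  fix a b :: "'a fls" and a' b'
  assume "tends_to a a'" "tends_to b b'"
  then obtain p q where "a = fps_to_fls p" "fps_nth p 0 = a'" "b = fps_to_fls q" "fps_nth q 0 = b'"
    by (auto simp: tends_to_iff_fps)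
  then show "tends_to (a * b) (a' * b')"
    by (auto simp: tends_to_iff_fps fls_times_fps_to_fls[symmetric])
next
  fix a :: "'a fls" and a'
  assume "tends_to a a'" "a' \<noteq> 0"
  then obtain p where p: "a = fps_to_fls p" "fps_nth p 0 = a'"
    by (auto simp: tends_to_iff_fps)
  then have "subdegree p = 0"
    using \<open>a' \<noteq> 0\<close> by simp
  then have "inverse a = fps_to_fls (inverse p)"
    by (simp add: p fls_inverse_fps_to_fls)
  then show "tends_to (inverse a) (inverse a')"
    using p by (auto simp: tends_to_iff_fps)
qed (auto simp: tends_to_def)

lemma tends_to_fls_const: "tends_to (fls_const f) f"
  by (auto simp: tends_to_def)

lemma tends_to_fls_X: "tends_to (fls_X :: 'a::zero_neq_one fls) 0"
  by (auto simp: tends_to_def)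

text \<open>
The square root needed below is taken in power series over a field of rational functions, which has to
be known to have characteristic zero.
\<close>

instance fract :: ("{idom, ring_char_0}") field_char_0
proof
  have of_nat: "of_nat n = Fraction_Field.Fract (of_nat n) (1 :: 'a)" for n
    by (induction n) (simp_all add: Zero_fract_def One_fract_def)
  show "inj (of_nat :: nat \<Rightarrow> 'a fract)"
    by (rule injI) (simp add: of_nat eq_fract)
qed

lemma fls_sqrt_exists:
  fixes h :: "'a::field_char_0 fls"
  assumes "tends_to h 1"
  obtains r where "r ^ 2 = h" "tends_to r 1"
proof -
  obtain p where p: "h = fps_to_fls p" "fps_nth p 0 = 1"
    using assms by (auto simp: tends_to_iff_fps)
  define q where "q = fps_radical (\<lambda>_ _. 1) (Suc 1) p"
  have "q ^ Suc 1 = p"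
    using power_radical[of p "\<lambda>_ _. 1" 1] p by (simp add: q_def)
  then have "fps_to_fls q ^ 2 = h"
    by (simp add: p numeral_2_eq_2 fls_times_fps_to_fls[symmetric])
  moreover have "tends_to (fps_to_fls q) 1"
    using p by (auto simp: tends_to_def q_def fps_radical_nth_0)
  ultimately show ?thesis using that by blast
qed

section \<open>The transformations at generic points\<close>

lemma (in field_hom) map_d5_maps:
  "map_d5 h (s0_map P) = s0_map (map_d5 h P)"
  "map_d5 h (s1_map P) = s1_map (map_d5 h P)"
  "map_d5 h (s2_map P) = s2_map (map_d5 h P)"
  "map_d5 h (s3_map P) = s3_map (map_d5 h P)"
  "map_d5 h (s4_map P) = s4_map (map_d5 h P)"
  "map_d5 h (s5_map P) = s5_map (map_d5 h P)"
  by (cases P; simp add: arith)+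

lemma d5_maps_involutive:
  "s0_map (s0_map P) = P" "s1_map (s1_map P) = P" "s2_map (s2_map P) = P"
  "s3_map (s3_map P) = P" "s4_map (s4_map P) = P" "s5_map (s5_map P) = P"
  by (cases P; simp)+

lemma a4_maps_involutive:
  "sigma0_map (sigma0_map Q) = Q" "sigma1_map (sigma1_map Q) = Q"
  "sigma2_map (sigma2_map Q) = Q" "sigma3_map (sigma3_map Q) = Q"
  "sigma4_map (sigma4_map Q) = Q"
proof -
  show "sigma0_map (sigma0_map Q) = Q"
  proof (cases Q)
    case (APt X Y Z W T a0 a1 a2 a3 a4)
    define \<phi> where "\<phi> = X - 2*Y - 2*W + 2*T"
    have "X - 2*a0/\<phi> - 2*(Y - a0/\<phi>) - 2*W + 2*T = \<phi>"
      by (simp add: \<phi>_def algebra_simps)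
    then show ?thesis
      by (simp add: APt Let_def flip: \<phi>_def)
  qed
qed (cases Q; simp)+

context place
begin

lemma rel_d5_maps:
  assumes "rel_d5 R P (DPt x y z w t a0 a1 a2 a3 a4 a5)" (is "rel_d5 R P ?P'")
  shows "y + t \<noteq> 0 \<Longrightarrow> rel_d5 R (s0_map P) (s0_map ?P')"
    "y \<noteq> 0 \<Longrightarrow> rel_d5 R (s1_map P) (s1_map ?P')"
    "x - z \<noteq> 0 \<Longrightarrow> rel_d5 R (s2_map P) (s2_map ?P')"
    "w \<noteq> 0 \<Longrightarrow> rel_d5 R (s3_map P) (s3_map ?P')"
    "z - 1 \<noteq> 0 \<Longrightarrow> rel_d5 R (s4_map P) (s4_map ?P')"
    "z \<noteq> 0 \<Longrightarrow> rel_d5 R (s5_map P) (s5_map ?P')"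
  using assms by (cases P; auto intro!: arith)+

lemma rel_a4_maps:
  assumes "rel_a4 R Q (APt X Y Z W T a0 a1 a2 a3 a4)" (is "rel_a4 R Q ?Q'")
  shows "X - 2*Y - 2*W + 2*T \<noteq> 0 \<Longrightarrow> rel_a4 R (sigma0_map Q) (sigma0_map ?Q')"
    "Y \<noteq> 0 \<Longrightarrow> rel_a4 R (sigma1_map Q) (sigma1_map ?Q')"
    "X - Z \<noteq> 0 \<Longrightarrow> rel_a4 R (sigma2_map Q) (sigma2_map ?Q')"
    "W \<noteq> 0 \<Longrightarrow> rel_a4 R (sigma3_map Q) (sigma3_map ?Q')"
    "Z \<noteq> 0 \<Longrightarrow> rel_a4 R (sigma4_map Q) (sigma4_map ?Q')"
  using assms by (cases Q; auto simp: Let_def intro!: arith)+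

end

context coeff_hom
begin

lemma rel_d5_generic:
  assumes "normalized_d5 P"
  shows "rel_d5 (evaluates_to c (d5_coord P)) d5_generic P"
proof (cases P)
  case (DPt x y z w t a0 a1 a2 a3 a4 a5)
  define R where "R = evaluates_to c (d5_coord P)"
  interpret place R unfolding R_def by (rule evaluates_to_place)
  have v: "R (rvar v) (d5_coord P v)" for v
    unfolding R_def by (rule evaluates_to_rvar)
  have a0: "a0 = 1 - a1 - 2*a2 - 2*a3 - a4 - a5"
    using assms by (simp add: DPt algebra_simps)
  show ?thesis
    unfolding R_def[symmetric] unfolding d5_generic_def DPt a0 d5.rel_inject
    using v[of Vx] v[of Vy] v[of Vz] v[of Vw] v[of Vt]
      v[of Va1] v[of Va2] v[of Va3] v[of Va4] v[of Va5]
    by (intro conjI arith) (simp_all add: DPt)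
qed

lemma rel_a4_generic:
  assumes "normalized_a4 Q"
  shows "rel_a4 (evaluates_to c (a4_coord Q)) a4_generic Q"
proof (cases Q)
  case (APt X Y Z W T a0 a1 a2 a3 a4)
  define R where "R = evaluates_to c (a4_coord Q)"
  interpret place R unfolding R_def by (rule evaluates_to_place)
  have v: "R (rvar v) (a4_coord Q v)" for v
    unfolding R_def by (rule evaluates_to_rvar)
  have a0: "a0 = 1 - a1 - a2 - a3 - a4"
    using assms by (simp add: APt algebra_simps)
  show ?thesis
    unfolding R_def[symmetric] unfolding a4_generic_def APt a0 a4.rel_inject
    using v[of VX] v[of VY] v[of VZ] v[of VW] v[of VT]
      v[of VA1] v[of VA2] v[of VA3] v[of VA4]
    by (intro conjI arith) (simp_all add: APt)
qed

lemma map_d5_ratfun_eval: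
  "rel_d5 (evaluates_to c g) P P' \<Longrightarrow> map_d5 (ratfun_eval c g) P = P'"
  by (cases P; cases P') (simp add: ratfun_eval_eqI)

lemma map_a4_ratfun_eval:
  "rel_a4 (evaluates_to c g) Q Q' \<Longrightarrow> map_a4 (ratfun_eval c g) Q = Q'"
  by (cases Q; cases Q') (simp add: ratfun_eval_eqI)

end

text \<open>
The place used is evaluation at \<open>m d5_generic\<close> itself: it sends the generic tuple to \<open>m d5_generic\<close>, hence
\<open>m d5_generic\<close> to \<open>m (m d5_generic)\<close>, which is the generic tuple again.
\<close>

lemma d5_involutive_substitution:
  assumes "normalized_d5 (m d5_generic)" "m (m d5_generic) = d5_generic"
    and "\<And>R. place R \<Longrightarrow> rel_d5 R d5_generic (m d5_generic) \<Longrightarrow>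
      rel_d5 R (m d5_generic) (m (m d5_generic))"
  shows "involutive_substitution (d5_coord (m d5_generic))"
proof
  fix v
  let ?R = "evaluates_to rconst (d5_coord (m d5_generic))"
  have "rel_d5 ?R (m d5_generic) d5_generic"
    using assms(3)[OF rconst.evaluates_to_place rconst.rel_d5_generic] assms(1,2) by simp
  then show "?R (d5_coord (m d5_generic) v) (rvar v)"
    by (cases "m d5_generic"; cases v) (simp_all add: d5_generic_def)
qed

lemma a4_involutive_substitution:
  assumes "normalized_a4 (m a4_generic)" "m (m a4_generic) = a4_generic"
    and "\<And>R. place R \<Longrightarrow> rel_a4 R a4_generic (m a4_generic) \<Longrightarrow>
      rel_a4 R (m a4_generic) (m (m a4_generic))"
  shows "involutive_substitution (a4_coord (m a4_generic))"
proof
  fix v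
  let ?R = "evaluates_to rconst (a4_coord (m a4_generic))"
  have "rel_a4 ?R (m a4_generic) a4_generic"
    using assms(3)[OF rconst.evaluates_to_place rconst.rel_a4_generic] assms(1,2) by simp
  then show "?R (a4_coord (m a4_generic) v) (rvar v)"
    by (cases "m a4_generic"; cases v) (simp_all add: a4_generic_def)
qed

text \<open>
A rational function is shown to be non-zero by exhibiting a complex point where its value is non-zero.
\<close>

lemma nonzero_if_value_nonzero:
  assumes "evaluates_to (\<lambda>a. a) g f r" "r \<noteq> 0"
  shows "f \<noteq> 0"
proof -
  interpret place "evaluates_to (\<lambda>a. a) g"
    by (rule coeff_hom.evaluates_to_place[OF coeff_hom_id])
  show ?thesis using assms by (rule nonzero)
qed

lemma rvar_nonzero [simp]: "rvar v \<noteq> 0"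
  using nonzero_if_value_nonzero[OF coeff_hom.evaluates_to_rvar[OF coeff_hom_id, of "\<lambda>_. 1"]]
  by simp

lemma rvar_diff_nonzero:
  assumes "u \<noteq> v"
  shows "rvar u - rvar v \<noteq> 0"
proof -
  let ?g = "\<lambda>x. if x = u then 1 else 0 :: complex"
  interpret coeff_hom "\<lambda>a. a" by (rule coeff_hom_id)
  interpret place "evaluates_to (\<lambda>a. a) ?g" by (rule evaluates_to_place)
  have "evaluates_to (\<lambda>a. a) ?g (rvar u - rvar v) (?g u - ?g v)"
    by (intro diff evaluates_to_rvar)
  then show ?thesis
    by (rule nonzero_if_value_nonzero) (use assms in simp)
qed

lemma d5_generic_denominators:
  "rvar Vy + rvar Vt \<noteq> 0" "rvar Vx - rvar Vz \<noteq> 0" "rvar Vz - 1 \<noteq> 0"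
proof -
  interpret coeff_hom "\<lambda>a. a" by (rule coeff_hom_id)
  let ?R = "evaluates_to (\<lambda>a. a) (\<lambda>v::dvar. 2 :: complex)"
  interpret place ?R by (rule evaluates_to_place)
  have "?R (rvar Vy + rvar Vt) (2 + 2)" "?R (rvar Vz - 1) (2 - 1)"
    by (intro arith evaluates_to_rvar)+
  then show "rvar Vy + rvar Vt \<noteq> 0" "rvar Vz - 1 \<noteq> 0"
    by (auto dest: nonzero_if_value_nonzero)
qed (rule rvar_diff_nonzero, simp)

lemma a4_generic_denominators:
  "rvar VX - 2 * rvar VY - 2 * rvar VW + 2 * rvar VT \<noteq> 0" "rvar VX - rvar VZ \<noteq> 0"
proof -
  interpret coeff_hom "\<lambda>a. a" by (rule coeff_hom_id)
  let ?R = "evaluates_to (\<lambda>a. a) (\<lambda>v::avar. 1 :: complex)"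
  interpret place ?R by (rule evaluates_to_place)
  have "?R (rvar VX - 2 * rvar VY - 2 * rvar VW + 2 * rvar VT) (1 - 2 * 1 - 2 * 1 + 2 * 1)"
    by (intro arith evaluates_to_rvar)
  then show "rvar VX - 2 * rvar VY - 2 * rvar VW + 2 * rvar VT \<noteq> 0"
    by (auto dest: nonzero_if_value_nonzero)
qed (rule rvar_diff_nonzero, simp)

text \<open>
Each transformation leaves the denominators that it introduces unchanged, so they are non-zero at the
transformed generic tuple as well.
\<close>

lemma rel_d5_generic_maps:
  fixes R :: "dfield \<Rightarrow> dfield \<Rightarrow> bool"
  assumes "place R"
  shows
    "rel_d5 R d5_generic (s0_map d5_generic) \<Longrightarrow>
      rel_d5 R (s0_map d5_generic) (s0_map (s0_map d5_generic))"
    "rel_d5 R d5_generic (s1_map d5_generic) \<Longrightarrow>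
      rel_d5 R (s1_map d5_generic) (s1_map (s1_map d5_generic))"
    "rel_d5 R d5_generic (s2_map d5_generic) \<Longrightarrow>
      rel_d5 R (s2_map d5_generic) (s2_map (s2_map d5_generic))"
    "rel_d5 R d5_generic (s3_map d5_generic) \<Longrightarrow>
      rel_d5 R (s3_map d5_generic) (s3_map (s3_map d5_generic))"
    "rel_d5 R d5_generic (s4_map d5_generic) \<Longrightarrow>
      rel_d5 R (s4_map d5_generic) (s4_map (s4_map d5_generic))"
    "rel_d5 R d5_generic (s5_map d5_generic) \<Longrightarrow>
      rel_d5 R (s5_map d5_generic) (s5_map (s5_map d5_generic))"
proof -
  interpret place R by (fact assms)
  obtain a0 where gen: "d5_generic = DPt (rvar Vx) (rvar Vy) (rvar Vz) (rvar Vw) (rvar Vt) a0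
     (rvar Va1) (rvar Va2) (rvar Va3) (rvar Va4) (rvar Va5)"
    by (simp add: d5_generic_def)
  note den = d5_generic_denominators rvar_nonzero
  show "rel_d5 R (s0_map d5_generic) (s0_map (s0_map d5_generic))"
    if "rel_d5 R d5_generic (s0_map d5_generic)"
    using rel_d5_maps(1)[OF that[unfolded gen s0_map.simps]] den by (simp add: gen)
  show "rel_d5 R (s1_map d5_generic) (s1_map (s1_map d5_generic))"
    if "rel_d5 R d5_generic (s1_map d5_generic)"
    using rel_d5_maps(2)[OF that[unfolded gen s1_map.simps]] den by (simp add: gen)
  show "rel_d5 R (s2_map d5_generic) (s2_map (s2_map d5_generic))"
    if "rel_d5 R d5_generic (s2_map d5_generic)"
    using rel_d5_maps(3)[OF that[unfolded gen s2_map.simps]] den by (simp add: gen)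
  show "rel_d5 R (s3_map d5_generic) (s3_map (s3_map d5_generic))"
    if "rel_d5 R d5_generic (s3_map d5_generic)"
    using rel_d5_maps(4)[OF that[unfolded gen s3_map.simps]] den by (simp add: gen)
  show "rel_d5 R (s4_map d5_generic) (s4_map (s4_map d5_generic))"
    if "rel_d5 R d5_generic (s4_map d5_generic)"
    using rel_d5_maps(5)[OF that[unfolded gen s4_map.simps]] den by (simp add: gen)
  show "rel_d5 R (s5_map d5_generic) (s5_map (s5_map d5_generic))"
    if "rel_d5 R d5_generic (s5_map d5_generic)"
    using rel_d5_maps(6)[OF that[unfolded gen s5_map.simps]] den by (simp add: gen)
qed

lemma rel_a4_generic_maps:
  fixes R :: "afield \<Rightarrow> afield \<Rightarrow> bool"
  assumes "place R"
  shows
    "rel_a4 R a4_generic (sigma0_map a4_generic) \<Longrightarrow>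
      rel_a4 R (sigma0_map a4_generic) (sigma0_map (sigma0_map a4_generic))"
    "rel_a4 R a4_generic (sigma1_map a4_generic) \<Longrightarrow>
      rel_a4 R (sigma1_map a4_generic) (sigma1_map (sigma1_map a4_generic))"
    "rel_a4 R a4_generic (sigma2_map a4_generic) \<Longrightarrow>
      rel_a4 R (sigma2_map a4_generic) (sigma2_map (sigma2_map a4_generic))"
    "rel_a4 R a4_generic (sigma3_map a4_generic) \<Longrightarrow>
      rel_a4 R (sigma3_map a4_generic) (sigma3_map (sigma3_map a4_generic))"
    "rel_a4 R a4_generic (sigma4_map a4_generic) \<Longrightarrow>
      rel_a4 R (sigma4_map a4_generic) (sigma4_map (sigma4_map a4_generic))"
proof -
  interpret place R by (fact assms)
  obtain a0 where gen: "a4_generic = APt (rvar VX) (rvar VY) (rvar VZ) (rvar VW) (rvar VT) a0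
     (rvar VA1) (rvar VA2) (rvar VA3) (rvar VA4)"
    by (simp add: a4_generic_def)
  note den = a4_generic_denominators rvar_nonzero
  show "rel_a4 R (sigma0_map a4_generic) (sigma0_map (sigma0_map a4_generic))"
    if "rel_a4 R a4_generic (sigma0_map a4_generic)"
  proof -
    let ?\<phi> = "rvar VX - 2 * rvar VY - 2 * rvar VW + 2 * rvar VT"
    have "rvar VX - 2 * a0 / ?\<phi> - 2 * (rvar VY - a0 / ?\<phi>) - 2 * rvar VW + 2 * rvar VT = ?\<phi>"
      by (simp add: algebra_simps)
    then show ?thesis
      using rel_a4_maps(1)[OF that[unfolded gen sigma0_map.simps Let_def]] den
      by (simp only: gen sigma0_map.simps Let_def not_False_eq_True)
  qed
  show "rel_a4 R (sigma1_map a4_generic) (sigma1_map (sigma1_map a4_generic))"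
    if "rel_a4 R a4_generic (sigma1_map a4_generic)"
    using rel_a4_maps(2)[OF that[unfolded gen sigma1_map.simps]] den by (simp add: gen)
  show "rel_a4 R (sigma2_map a4_generic) (sigma2_map (sigma2_map a4_generic))"
    if "rel_a4 R a4_generic (sigma2_map a4_generic)"
    using rel_a4_maps(3)[OF that[unfolded gen sigma2_map.simps]] den by (simp add: gen)
  show "rel_a4 R (sigma3_map a4_generic) (sigma3_map (sigma3_map a4_generic))"
    if "rel_a4 R a4_generic (sigma3_map a4_generic)"
    using rel_a4_maps(4)[OF that[unfolded gen sigma3_map.simps]] den by (simp add: gen)
  show "rel_a4 R (sigma4_map a4_generic) (sigma4_map (sigma4_map a4_generic))"
    if "rel_a4 R a4_generic (sigma4_map a4_generic)"
    using rel_a4_maps(5)[OF that[unfolded gen sigma4_map.simps]] den by (simp add: gen)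
qed

lemma s_substitutions:
  "involutive_substitution (d5_coord (s0_map d5_generic))"
  "involutive_substitution (d5_coord (s1_map d5_generic))"
  "involutive_substitution (d5_coord (s2_map d5_generic))"
  "involutive_substitution (d5_coord (s3_map d5_generic))"
  "involutive_substitution (d5_coord (s4_map d5_generic))"
  "involutive_substitution (d5_coord (s5_map d5_generic))"
  by (intro d5_involutive_substitution rel_d5_generic_maps d5_maps_involutive
      normalized_d5_maps normalized_d5_generic; assumption)+

lemma sigma_substitutions:
  "involutive_substitution (a4_coord (sigma0_map a4_generic))"
  "involutive_substitution (a4_coord (sigma1_map a4_generic))"
  "involutive_substitution (a4_coord (sigma2_map a4_generic))"
  "involutive_substitution (a4_coord (sigma3_map a4_generic))"
  "involutive_substitution (a4_coord (sigma4_map a4_generic))"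
  by (intro a4_involutive_substitution rel_a4_generic_maps a4_maps_involutive
      normalized_a4_maps normalized_a4_generic; assumption)+

section \<open>The groups of transformations\<close>

lemma s_in_Bij:
  "d5_subst s0_map \<in> Bij UNIV" "d5_subst s1_map \<in> Bij UNIV" "d5_subst s2_map \<in> Bij UNIV"
  "d5_subst s3_map \<in> Bij UNIV" "d5_subst s4_map \<in> Bij UNIV" "d5_subst s5_map \<in> Bij UNIV"
  unfolding d5_subst_def by (intro involutive_substitution.in_Bij s_substitutions)+

lemma sigmas_in_Bij: "set sigmas \<subseteq> Bij UNIV"
  unfolding sigmas_def a4_subst_def
  using involutive_substitution.in_Bij[OF sigma_substitutions(1)]
    involutive_substitution.in_Bij[OF sigma_substitutions(2)]
    involutive_substitution.in_Bij[OF sigma_substitutions(3)]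
    involutive_substitution.in_Bij[OF sigma_substitutions(4)]
    involutive_substitution.in_Bij[OF sigma_substitutions(5)]
  by simp

lemma carrier_BijGroup: "carrier (BijGroup S) = Bij S"
  by (simp add: BijGroup_def)

lemma W_A4_generated: "carrier W_A4 = generate W_A4 (set sigmas)"
proof -
  interpret group "BijGroup (UNIV :: afield set)" by (rule group_BijGroup)
  have "subgroup (generate (BijGroup UNIV) (set sigmas)) (BijGroup UNIV)"
    by (rule generate_is_subgroup) (simp add: carrier_BijGroup sigmas_in_Bij)
  then show ?thesis
    unfolding W_A4_def
    by (subst generate_consistent) (auto intro: generate.incl)
qed

abbreviation s_generators :: "(dfield \<Rightarrow> dfield) set" where
  "s_generators \<equiv> {d5_subst s0_map, d5_subst s1_map, d5_subst s2_map,
      d5_subst s3_map, d5_subst s4_map, d5_subst s5_map}"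

lemma carrier_W_D5: "carrier W_D5 = generate (BijGroup UNIV) s_generators"
  by (simp add: W_D5_def)

lemma W_D5_subgroup: "subgroup (carrier W_D5) (BijGroup UNIV)"
  unfolding carrier_W_D5
  by (rule group.generate_is_subgroup[OF group_BijGroup])
    (simp add: carrier_BijGroup s_in_Bij)

lemma W_D5_group: "group W_D5"
  using group.subgroup_imp_group[OF group_BijGroup W_D5_subgroup]
  by (simp add: W_D5_def)

lemma s_in_W_D5: "s_generators \<subseteq> carrier W_D5"
  unfolding carrier_W_D5 by (auto intro: generate.incl)

lemma comp_in_W_D5:
  assumes "f \<in> carrier W_D5" "g \<in> carrier W_D5"
  shows "f \<circ> g \<in> carrier W_D5"
proof -
  have "f \<in> Bij UNIV" "g \<in> Bij UNIV"
    using assms subgroup.subset[OF W_D5_subgroup] by (auto simp: carrier_BijGroup)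
  then have "f \<circ> g = f \<otimes>\<^bsub>BijGroup UNIV\<^esub> g"
    by (auto simp: BijGroup_def compose_def)
  then show ?thesis
    using subgroup.m_closed[OF W_D5_subgroup assms] by simp
qed

section \<open>The degenerating tuple\<close>

lemma field_hom_d5_subst:
  "field_hom (d5_subst s0_map)" "field_hom (d5_subst s1_map)" "field_hom (d5_subst s2_map)"
  "field_hom (d5_subst s3_map)" "field_hom (d5_subst s4_map)" "field_hom (d5_subst s5_map)"
  unfolding d5_subst_def by (intro involutive_substitution.field_hom_ratfun_eval s_substitutions)+

text \<open>
Substituting into the dropped coordinate \<open>\<alpha>\<^sub>0 = 1 - \<alpha>\<^sub>1 - \<dots>\<close> gives the right value because the
transformed tuple is normalized.
\<close>

lemma map_d5_subst_generic:
  assumes "normalized_d5 (m d5_generic)"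
  shows "map_d5 (d5_subst m) d5_generic = m d5_generic"
  unfolding d5_subst_def
  by (intro rconst.map_d5_ratfun_eval rconst.rel_d5_generic assms)

lemma map_a4_subst_generic:
  assumes "normalized_a4 (m a4_generic)"
  shows "map_a4 (a4_subst m) a4_generic = m a4_generic"
  unfolding a4_subst_def
  by (intro rconst.map_a4_ratfun_eval rconst.rel_a4_generic assms)

definition degeneration_point :: "aseries d5" where
  "degeneration_point = change_vars fls_X (map_a4 fls_const a4_generic)"

text \<open>
The graph of \<^const>\<open>degeneration\<close> as a place. Only finitely many explicit functions have to be degenerated, and
their denominators are checked one by one, by their leading terms in \<open>\<epsilon>\<close>.
\<close>

definition degenerates_to :: "dfield \<Rightarrow> aseries \<Rightarrow> bool" where
  "degenerates_to = evaluates_to (\<lambda>c. fls_const (rconst c)) (d5_coord degeneration_point)"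

interpretation fls_rconst: coeff_hom "\<lambda>c. fls_const (rconst c)"
  by (rule coeff_hom_fls_const_rconst)

interpretation degenerates_to: place degenerates_to
  unfolding degenerates_to_def by (rule fls_rconst.evaluates_to_place)

lemma fls_const_field_hom: "field_hom fls_const"
  by standard (simp_all add: fls_plus_const)

lemma normalized_degeneration_point: "normalized_d5 degeneration_point"
proof -
  interpret field_hom "fls_const :: afield \<Rightarrow> aseries" by (rule fls_const_field_hom)
  have "normalized_a4 (map_a4 fls_const a4_generic)"
    by (simp add: a4_generic_def diff one del: fls_const_1)
  then show ?thesis
    unfolding degeneration_point_def by (rule normalized_change_vars)
qed

lemma degenerates_to_generic: "rel_d5 degenerates_to d5_generic degeneration_point"
  unfolding degenerates_to_def
  by (rule fls_rconst.rel_d5_generic) (rule normalized_degeneration_point)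

lemma map_d5_degeneration:
  assumes "rel_d5 degenerates_to (map_d5 S d5_generic) P"
  shows "map_d5 (\<lambda>f. degeneration (S f)) d5_generic = P"
proof -
  have "map_d5 degeneration (map_d5 S d5_generic) = P"
    using assms unfolding degeneration_def degenerates_to_def degeneration_point_def
    by (rule fls_rconst.map_d5_ratfun_eval)
  then show ?thesis
    by (simp add: d5.map_comp comp_def)
qed

section \<open>Passing to the limit\<close>

interpretation tends_to: place "tends_to :: aseries \<Rightarrow> afield \<Rightarrow> bool"
  by (rule tends_to_place)

lemma two_nonzero: "(2 :: aseries) \<noteq> 0"
  using tends_to.nonzero[OF tends_to.numeral[of "num.Bit0 num.One"]] by simp

text \<open>
The inverse of the change of variables. If \<open>\<alpha>\<^sub>4 = -(1/(2e\<^sup>2) + k)\<close>, then the new value of \<open>\<epsilon>\<close> is \<open>e/r\<close> with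
\<open>r\<^sup>2 = 1 + 2 e\<^sup>2 k\<close>. The old variables are given by \<open>x, y, z, w\<close> after the powers of \<open>e\<close> that
they carry to leading order have been split off; in these, the new variables have no negative powers of
\<open>e\<close>, which is what makes the limit visible.
\<close>

lemma change_vars_scaled:
  fixes e r k :: "'a::field"
  assumes "2 * e^2 * b = 1" "r \<noteq> 0" "r^2 = 1 + 2 * e^2 * k" "1 - e*x \<noteq> 0" "1 - e*z \<noteq> 0"
  shows "change_vars (e/r)
      (APt (- (r*x / (1 - e*x))) ((e*(1 - e*x)*A1 - (1 - e*x)^2*y) / r)
        (- (r*z / (1 - e*z))) ((e*(1 - e*z)*A3 - (1 - e*z)^2*w) / r)
        ((T - e*k) / r) A0 A1 A2 A3 A4) =
    DPt (e*x) (y/e) (e*z) (w/e) (b * (1 + 2*e*T))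
      (A0 - A2 - A3 + (b + k)) A1 A2 A3 (- (b + k)) A4"
proof -
  have e: "e \<noteq> 0" and two: "(2::'a) \<noteq> 0"
    using assms(1) by auto
  then have b: "b = 1 / (2 * e^2)"
    using assms(1) by (simp add: nonzero_eq_divide_eq mult.commute)
  have alpha: "1 / (2 * (e/r)^2) = b + k"
    using assms(3) e two by (simp add: b field_simps)
  have x: "- (e/r * - (r*x / (1 - e*x)) / (1 - e/r * - (r*x / (1 - e*x)))) = e*x"
    and scale: "1 - e/r * - (r*x / (1 - e*x)) = 1 / (1 - e*x)"
    if "1 - e*x \<noteq> 0" for x
  proof -
    show scale: "1 - e/r * - (r*x / (1 - e*x)) = 1 / (1 - e*x)"
      using that assms(2) by (simp add: field_simps)
    show "- (e/r * - (r*x / (1 - e*x)) / (1 - e/r * - (r*x / (1 - e*x)))) = e*x"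
      unfolding scale using that assms(2) by simp
  qed
  have y: "- (1 / (e/r)) * (1 - e/r * - (r*x / (1 - e*x))) *
      (Y - e/r * (A + - (r*x / (1 - e*x)) * Y)) = y/e"
    if "1 - e*x \<noteq> 0" "Y = (e*(1 - e*x)*A - (1 - e*x)^2*y) / r" for x y Y A
  proof -
    define u where "u = 1 - e*x"
    have "Y - e/r * (A + - (r*x / (1 - e*x)) * Y) = (1 - e/r * - (r*x / (1 - e*x))) * Y - e/r * A"
      by (simp add: algebra_simps)
    also have "\<dots> = 1 / u * Y - e/r * A"
      unfolding scale[OF that(1)] u_def ..
    also have "\<dots> = - (u * y / r)"
      using that(1) assms(2) unfolding that(2) u_def[symmetric]
      by (simp add: field_simps power2_eq_square)
    finally show ?thesis
      unfolding scale[OF that(1)] using that(1) assms(2) e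
      unfolding u_def[symmetric] by simp
  qed
  have t: "1 / (2 * (e/r)^2) * (1 + 2 * (e/r) * ((T - e*k) / r)) = b * (1 + 2*e*T)"
  proof -
    have "1 / (2 * (e/r)^2) * (1 + 2 * (e/r) * ((T - e*k) / r)) = (r^2 + 2*e*(T - e*k)) / (2*e^2)"
      using assms(2) e two by (simp add: field_simps power2_eq_square)
    also have "r^2 + 2*e*(T - e*k) = 1 + 2*e*T"
      unfolding assms(3) by (simp add: algebra_simps power2_eq_square)
    finally show ?thesis by (simp add: b)
  qed
  show ?thesis
    unfolding change_vars.simps t unfolding alpha
    using x[OF assms(4)] x[OF assms(5)] y[OF assms(4) refl] y[OF assms(5) refl] by simp
qed

text \<open>
At \<open>e = 0\<close> the inverse change of variables is just a change of sign of the rescaled variables. Of the two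
possible images of \<open>\<epsilon>\<close>, the one with \<open>r \<rightarrow> 1\<close> is chosen; the other one would change the signs of
\<open>X, Y, Z, W, T\<close> in the limit.
\<close>

lemma induced_action_limit:
  fixes e b x y z w a0 a1 a2 a3 a4 k :: aseries
  assumes S: "map_d5 (\<lambda>f. degeneration (S f)) d5_generic =
      DPt (e*x) (y/e) (e*z) (w/e) (b * (1 + 2*e*t))
        (a0 - a2 - a3 + (b + k)) a1 a2 a3 (- (b + k)) a4"
    and e: "tends_to e 0" and b: "2 * e^2 * b = 1"
    and lim: "tends_to x (- X)" "tends_to y (- Y)" "tends_to z (- Z)" "tends_to w (- W)"
      "tends_to t T" "tends_to a0 A0" "tends_to a1 A1" "tends_to a2 A2" "tends_to a3 A3"
      "tends_to a4 A4" "tends_to k \<kappa>"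
  shows "\<exists>E Q. induced_action S E Q \<and> rel_a4 tends_to Q (APt X Y Z W T A0 A1 A2 A3 A4)"
proof -
  have "tends_to (1 + 2 * e^2 * k) (1 + 2 * 0^2 * \<kappa>)"
    by (intro tends_to.arith e lim)
  then obtain r where r: "r^2 = 1 + 2 * e^2 * k" "tends_to r 1"
    by (auto elim: fls_sqrt_exists)
  have u: "tends_to (1 - e*v) (1 - 0*V)" if "tends_to v V" for v :: aseries and V
    by (intro tends_to.arith e that)
  have nz: "r \<noteq> 0" "1 - e*x \<noteq> 0" "1 - e*z \<noteq> 0"
    using tends_to.nonzero[OF r(2)] tends_to.nonzero[OF u[OF lim(1)]]
      tends_to.nonzero[OF u[OF lim(3)]] by simp_all
  let ?Q = "APt (- (r*x / (1 - e*x))) ((e*(1 - e*x)*a1 - (1 - e*x)^2*y) / r)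
        (- (r*z / (1 - e*z))) ((e*(1 - e*z)*a3 - (1 - e*z)^2*w) / r)
        ((t - e*k) / r) a0 a1 a2 a3 a4"
  have "induced_action S (e / r) ?Q"
    unfolding induced_action_def S change_vars_scaled[OF b nz(1) r(1) nz(2,3)]
    using nz b by auto
  moreover have "tends_to (- (r*x / (1 - e*x))) (- (1 * (- X) / (1 - 0*(- X))))"
      "tends_to (- (r*z / (1 - e*z))) (- (1 * (- Z) / (1 - 0*(- Z))))"
      "tends_to ((e*(1 - e*x)*a1 - (1 - e*x)^2*y) / r)
        ((0 * (1 - 0*(- X)) * A1 - (1 - 0*(- X))^2 * (- Y)) / 1)"
      "tends_to ((e*(1 - e*z)*a3 - (1 - e*z)^2*w) / r)
        ((0 * (1 - 0*(- Z)) * A3 - (1 - 0*(- Z))^2 * (- W)) / 1)"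
      "tends_to ((t - e*k) / r) ((T - 0*\<kappa>) / 1)"
    by (intro tends_to.arith e lim r(2); simp)+
  then have "rel_a4 tends_to ?Q (APt X Y Z W T A0 A1 A2 A3 A4)"
    using lim by simp
  ultimately show ?thesis by blast
qed

text \<open>
The reflection in \<open>A\<^sub>0 = \<alpha>\<^sub>0 + \<alpha>\<^sub>2 + \<alpha>\<^sub>3 + \<alpha>\<^sub>4\<close>, computed letter by letter. The parameters involved are of order
\<open>1/e\<^sup>2\<close>, so the terms of that order must be cancelled algebraically before any limit is taken. All
auxiliary quantities are chosen such that they are regular at \<open>e = 0\<close>:
after \<open>s\<^sub>0\<close> the variable \<open>x\<close> is \<open>1 + e x1\<close> rather than of order \<open>e\<close>; \<open>D\<close> and \<open>D1\<close> are the denominators of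
the two occurrences of \<open>s\<^sub>2\<close>, and \<open>b N\<close> and \<open>b N2\<close> those of the two occurrences of \<open>s\<^sub>0\<close>; \<open>\<omega>/e\<close> is the value of
\<open>w\<close> met by \<open>s\<^sub>3\<close>, and \<open>\<omega>\<close> will tend to \<open>\<phi>/2\<close>; and \<open>\<sigma>/e\<close> is what the two occurrences of \<open>s\<^sub>2\<close>
together subtract from \<open>y\<close>.
\<close>

lemma (in place) reflection_word:
  fixes e b :: 'b
  assumes b: "2 * e^2 * b = 1"
    and P: "rel_d5 R P (DPt (e*x) (y/e) (e*z) (w/e) (b * (1 + 2*e*T))
      (A0 - A2 - A3 + b) A1 A2 A3 (- b) A4)"
    and N: "N = 1 + 2*e*(T + y)" "N \<noteq> 0"
    and x1: "x1 = x + (2*e*(A0 - A2 - A3) - 2*(T + y)) / N"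
    and D: "D = 1 + e*(x1 - z)" "D \<noteq> 0"
    and ze: "1 - e*z \<noteq> 0"
    and \<omega>: "\<omega> = w + (2*e*(A0 - A3)*(1 - e*z) - x1) / (2*D*(1 - e*z))" "\<omega> \<noteq> 0"
    and z1: "z1 = z + A0/\<omega>"
    and D1: "D1 = 1 + e*(x1 - z1)" "D1 \<noteq> 0"
    and ze1: "1 - e*z1 \<noteq> 0"
    and \<sigma>: "\<sigma> = (e*((A0 - A3)*D1 + A3*D) - A0/(2*\<omega>)) / (D*D1)"
    and y2: "y2 = y - \<sigma>"
    and N2: "N2 = 1 + 2*e*(T + y2)" "N2 \<noteq> 0"
    and x2: "x2 = (x1*N2 + 2*(T + y2) + 2*e*(A2 + A3)) / N2"
    and w2: "w2 = w + \<sigma> + A0 / (2*\<omega>*(1 - e*z)*(1 - e*z1)) + e*A0 / (1 - e*z1)"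
  shows "rel_d5 R (s0_map (s4_map (s2_map (s3_map (s2_map (s4_map (s0_map P)))))))
    (DPt (e*x2) (y2/e) (e*z1) (w2/e) (b * (1 + 2*e*T))
      (b - A2 - A3) (A1 + A0) A2 A3 (- (b + A0)) (A4 + A0))"
proof -
  have e: "e \<noteq> 0" and two: "(2::'b) \<noteq> 0" and bnz: "b \<noteq> 0"
    using b by auto
  then have b': "b = 1 / (2 * e^2)"
    using b by (simp add: nonzero_eq_divide_eq mult.commute)
  have shift: "c + b = b * (1 + 2 * e^2 * c)" "c - b = - (b * (1 - 2 * e^2 * c))" for c
    using b by (simp_all add: algebra_simps)
  have ye: "y'/e + b * (1 + 2*e*T) = b * (1 + 2*e*(T + y'))" for y'
    using e two by (simp add: b' field_simps power2_eq_square)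
  let ?t = "b * (1 + 2*e*T)"
  have "e*x + (A0 - A2 - A3 + b) / (b * N) = e*x + (1 + 2 * e^2 * (A0 - A2 - A3)) / N"
    unfolding shift using bnz by simp
  also have "\<dots> = 1 + e*x1"
  proof -
    have "1 + 2 * e^2 * (A0 - A2 - A3) = N + e * (2*e*(A0 - A2 - A3) - 2*(T + y))"
      by (simp add: N(1) algebra_simps power2_eq_square)
    then have "(1 + 2 * e^2 * (A0 - A2 - A3)) / N =
        1 + e * ((2*e*(A0 - A2 - A3) - 2*(T + y)) / N)"
      using N(2) by (simp add: add_divide_distrib)
    then show ?thesis by (simp add: x1 distrib_left)
  qed
  finally have "e*x + (A0 - A2 - A3 + b) / (b * N) = 1 + e*x1" .
  moreover have "y/e + ?t = b * N"
    unfolding ye N(1) ..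
  moreover have "A2 + (A0 - A2 - A3 + b) = A0 - A3 + b"
    by simp
  ultimately have "rel_d5 R (s0_map P) (DPt (1 + e*x1) (y/e) (e*z) (w/e) ?t
      (- (A0 - A2 - A3 + b)) A1 (A0 - A3 + b) A3 (- b) A4)"
    using rel_d5_maps(1)[OF P] N(2) bnz by (metis mult_eq_0_iff s0_map.simps)
  from rel_d5_maps(5)[OF this] ze
  have "rel_d5 R (s4_map (s0_map P)) (DPt (1 + e*x1) (y/e) (e*z) (w/e - (- b)/(e*z - 1)) ?t
      (- (A0 - A2 - A3 + b)) A1 (A0 - A3 + b) (A3 + (- b)) (- (- b)) A4)"
    unfolding s4_map.simps by simp
  moreover have D': "1 + e*x1 - e*z = D"
    by (simp add: D algebra_simps)
  \<comment> \<open>The poles \<open>1/e\<^sup>2\<close> contributed to \<open>w\<close> by \<open>s\<^sub>4\<close> and by \<open>s\<^sub>2\<close> cancel.\<close>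
  moreover have \<omega>': "w/e - (- b)/(e*z - 1) + (A0 - A3 + b) / D = \<omega>/e"
  proof -
    have "w/e - (- b)/(e*z - 1) + (A0 - A3 + b) / D = w/e + ((A0 - A3 + b) / D - b / (1 - e*z))"
      using ze by (simp add: field_simps)
    also have "(A0 - A3 + b) / D - b / (1 - e*z) =
        ((A0 - A3)*(1 - e*z) + b*((1 - e*z) - D)) / (D*(1 - e*z))"
      using ze D(2) by (simp add: diff_frac_eq algebra_simps)
    also have "b*((1 - e*z) - D) = - x1 / (2*e)"
      using e two by (simp add: D b' field_simps power2_eq_square)
    also have "w/e + ((A0 - A3)*(1 - e*z) + - x1 / (2*e)) / (D*(1 - e*z)) = \<omega>/e"
      using ze D(2) e two unfolding \<omega>(1) by (simp add: divide_simps)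
    finally show ?thesis .
  qed
  ultimately have "rel_d5 R (s2_map (s4_map (s0_map P)))
      (DPt (1 + e*x1) (y/e - (A0 - A3 + b)/D) (e*z) (\<omega>/e) ?t
        A2 (A1 + (A0 - A3 + b)) (- (A0 - A3 + b)) A0 b A4)"
    using rel_d5_maps(3)[of "s4_map (s0_map P)"] D(2) by fastforce

  moreover have "- (A0 - A3 + b) + A0 = A3 - b"
    by simp
  moreover have "e*z + A0 / (\<omega>/e) = e*z1"
    using \<omega>(2) by (simp add: z1 distrib_left mult.commute)
  ultimately have "rel_d5 R (s3_map (s2_map (s4_map (s0_map P))))
      (DPt (1 + e*x1) (y/e - (A0 - A3 + b)/D) (e*z1) (\<omega>/e) ?t
        A2 (A1 + (A0 - A3 + b)) (A3 - b) (- A0) (b + A0) (A4 + A0))"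
    using rel_d5_maps(4)[of "s2_map (s4_map (s0_map P))"] \<omega>(2) e by fastforce
  moreover have D1': "1 + e*x1 - e*z1 = D1"
    by (simp add: D1 algebra_simps)
  \<comment> \<open>\<open>\<alpha>\<^sub>2\<close> is about \<open>b\<close> at the first \<open>s\<^sub>2\<close> and about \<open>-b\<close> at the second one, and \<open>D1 - D\<close> is of order \<open>e\<close>.\<close>
  moreover have \<sigma>': "(A0 - A3 + b)/D + (A3 - b)/D1 = \<sigma>/e"
  proof -
    have "(A0 - A3 + b)/D + (A3 - b)/D1 = ((A0 - A3)*D1 + A3*D + b*(D1 - D)) / (D*D1)"
      using D(2) D1(2) by (simp add: add_frac_eq algebra_simps)
    also have "b*(D1 - D) = - (A0 / (2*\<omega>)) / e"
      using e two \<omega>(2) by (simp add: D D1 z1 b' field_simps power2_eq_square)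
    also have "(A0 - A3)*D1 + A3*D + - (A0 / (2*\<omega>)) / e =
        (e*((A0 - A3)*D1 + A3*D) - A0 / (2*\<omega>)) / e"
      using e by (simp add: diff_divide_distrib)
    also have "\<dots> / (D*D1) = \<sigma>/e"
      by (simp add: \<sigma> mult_ac)
    finally show ?thesis .
  qed
  moreover have "y/e - (A0 - A3 + b)/D - (A3 - b)/D1 = y2/e"
  proof -
    have "y/e - (A0 - A3 + b)/D - (A3 - b)/D1 = y/e - ((A0 - A3 + b)/D + (A3 - b)/D1)"
      by simp
    then show ?thesis
      unfolding \<sigma>' by (simp add: y2 diff_divide_distrib)
  qed
  moreover have "A1 + (A0 - A3 + b) + (A3 - b) = A1 + A0"
    by simp
  ultimately have "rel_d5 R (s2_map (s3_map (s2_map (s4_map (s0_map P)))))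
      (DPt (1 + e*x1) (y2/e) (e*z1) (\<omega>/e + (A3 - b)/D1) ?t
        (A2 + (A3 - b)) (A1 + A0) (- (A3 - b)) (- A0 + (A3 - b)) (b + A0) (A4 + A0))"
    using rel_d5_maps(3)[of "s3_map (s2_map (s4_map (s0_map P)))"] D1(2) by fastforce
  \<comment> \<open>The second \<open>s\<^sub>4\<close> meets the value of \<open>z\<close> moved by \<open>s\<^sub>3\<close>, so the two contributions of \<open>s\<^sub>4\<close>
    no longer cancel; what remains compensates \<open>\<sigma>\<close> in the limit.\<close>
  moreover have "\<omega>/e + (A3 - b)/D1 - (b + A0)/(e*z1 - 1) = w2/e"
  proof -
    have flip: "c / (v - 1) = - (c / (1 - v))" for c v :: 'b
      by (metis minus_diff_eq minus_divide_right)
    have "\<omega>/e + (A3 - b)/D1 - (b + A0)/(e*z1 - 1) =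
        w/e + ((A0 - A3 + b)/D + (A3 - b)/D1) + (b / (1 - e*z1) - b / (1 - e*z)) + A0 / (1 - e*z1)"
      unfolding \<omega>'[symmetric] flip by (simp add: add_divide_distrib)
    also have "b / (1 - e*z1) - b / (1 - e*z) = b * (e * (z1 - z)) / ((1 - e*z1) * (1 - e*z))"
      using ze ze1 by (simp add: diff_frac_eq algebra_simps)
    also have "b * (e * (z1 - z)) = A0 / (2*\<omega>) / e"
      using e two by (simp add: z1 b' power2_eq_square)
    finally show ?thesis
      unfolding \<sigma>' using e by (simp add: w2 add_divide_distrib mult_ac
          del: left_diff_distrib_numeral right_diff_distrib_numeral)
  qed
  moreover have "- A0 + (A3 - b) + (b + A0) = A3"
    by simp
  moreover have "e*z1 - 1 \<noteq> 0"
    using ze1 by simp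
  ultimately have "rel_d5 R (s4_map (s2_map (s3_map (s2_map (s4_map (s0_map P))))))
      (DPt (1 + e*x1) (y2/e) (e*z1) (w2/e) ?t
        (A2 + (A3 - b)) (A1 + A0) (- (A3 - b)) A3 (- (b + A0)) (A4 + A0))"
    using rel_d5_maps(5)[of "s2_map (s3_map (s2_map (s4_map (s0_map P))))"] by fastforce
  \<comment> \<open>The second \<open>s\<^sub>0\<close> removes the constant term \<open>1\<close> that the first one has added to \<open>x\<close>.\<close>
  moreover have "1 + e*x1 + (A2 + (A3 - b)) / (b * N2) = e*x2"
  proof -
    have "A2 + (A3 - b) = - (b * (1 - 2 * e^2 * (A2 + A3)))"
      using shift(2)[of "A2 + A3"] by (simp only: add_diff_eq)
    then have "1 + e*x1 + (A2 + (A3 - b)) / (b * N2) = 1 + e*x1 - (1 - 2 * e^2 * (A2 + A3)) / N2"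
      using bnz by simp
    also have "\<dots> = (N2 + e*x1*N2 - (1 - 2 * e^2 * (A2 + A3))) / N2"
      using N2(2) by (simp add: field_simps)
    also have "N2 + e*x1*N2 - (1 - 2 * e^2 * (A2 + A3)) =
        e * (x1*N2 + 2*(T + y2) + 2*e*(A2 + A3))"
      by (simp add: N2(1) algebra_simps power2_eq_square)
    finally show ?thesis by (simp add: x2)
  qed
  moreover have "- (A3 - b) + (A2 + (A3 - b)) = A2" "- (A2 + (A3 - b)) = b - A2 - A3"
    by simp_all
  moreover have "y2/e + ?t = b * N2"
    unfolding ye N2(1) ..
  ultimately show ?thesis
    using rel_d5_maps(1)[of "s4_map (s2_map (s3_map (s2_map (s4_map (s0_map P)))))"] N2(2) bnz
    by (metis mult_eq_0_iff s0_map.simps)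
qed

text \<open>
Names the entries of the degenerating tuple up to the powers of \<open>e = \<epsilon>\<close> that they carry, so that later
arguments use only their limits and the relation \<open>b = 1/(2e\<^sup>2)\<close>.
\<close>

lemma degeneration_point_scaled:
  obtains e x y z w t a0 a1 a2 a3 a4 b and A0 :: afield where
    "degeneration_point = DPt (e*x) (y/e) (e*z) (w/e) (b * (1 + 2*e*t))
      (a0 - a2 - a3 + b) a1 a2 a3 (- b) a4"
    "2 * e^2 * b = 1"
    "a4_generic = APt (rvar VX) (rvar VY) (rvar VZ) (rvar VW) (rvar VT) A0
      (rvar VA1) (rvar VA2) (rvar VA3) (rvar VA4)"
    "tends_to x (- rvar VX)" "tends_to y (- rvar VY)" "tends_to z (- rvar VZ)"
    "tends_to w (- rvar VW)" "tends_to t (rvar VT)" "tends_to a0 A0" "tends_to a1 (rvar VA1)"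
    "tends_to a2 (rvar VA2)" "tends_to a3 (rvar VA3)" "tends_to a4 (rvar VA4)" "tends_to e 0"
proof -
  define e :: aseries where "e = fls_X"
  define c :: "avar \<Rightarrow> aseries" where "c v = fls_const (rvar v)" for v
  let ?A0 = "1 - rvar VA1 - rvar VA2 - rvar VA3 - rvar VA4 :: afield"
  let ?u = "\<lambda>v. 1 - e * c v"
  have e: "tends_to e 0" "e \<noteq> 0"
    by (simp_all add: e_def tends_to_fls_X)
  have c: "tends_to (c v) (rvar v)" for v
    unfolding c_def by (rule tends_to_fls_const)
  have x: "tends_to (- c v / ?u v) (- rvar v / (1 - 0 * rvar v))" for v
    by (intro tends_to.arith e c) simp
  have y: "tends_to (- (?u v * (c u - e * (c a + c v * c u))))
      (- ((1 - 0 * rvar v) * (rvar u - 0 * (rvar a + rvar v * rvar u))))" for u v a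
    by (intro tends_to.arith e c)
  have "degeneration_point = change_vars e (APt (c VX) (c VY) (c VZ) (c VW) (c VT) (fls_const ?A0)
      (c VA1) (c VA2) (c VA3) (c VA4))"
    by (simp add: degeneration_point_def a4_generic_def e_def c_def del: change_vars.simps)
  then have point: "degeneration_point =
      DPt (e * (- c VX / ?u VX)) (- (?u VX * (c VY - e * (c VA1 + c VX * c VY))) / e)
        (e * (- c VZ / ?u VZ)) (- (?u VZ * (c VW - e * (c VA3 + c VZ * c VW))) / e)
        (1 / (2 * e^2) * (1 + 2*e*c VT)) (fls_const ?A0 - c VA2 - c VA3 + 1 / (2 * e^2))
        (c VA1) (c VA2) (c VA3) (- (1 / (2 * e^2))) (c VA4)"
    by simp
  show ?thesis
    by (rule that[OF point])
      (use x y c e two_nonzero tends_to_fls_const[of ?A0] in \<open>simp_all add: a4_generic_def\<close>)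
qed

lemma map_d5_degeneration_of:
  assumes "rel_d5 degenerates_to (m d5_generic) P" "map_d5 S d5_generic = m d5_generic"
  shows "map_d5 (\<lambda>f. degeneration (S f)) d5_generic = P"
  using map_d5_degeneration assms by simp

text \<open>
For \<open>s\<^sub>1, s\<^sub>2, s\<^sub>3, s\<^sub>5\<close> the shift of the transformed variable has the same order in \<open>\<epsilon>\<close> as the variable itself.
Only \<open>s\<^sub>3\<close> moves \<open>\<alpha>\<^sub>4\<close> and hence \<open>\<epsilon>\<close>.
\<close>

lemma limits_simple_reflections:
  "\<exists>E Q. induced_action (d5_subst s1_map) E Q \<and> rel_a4 tends_to Q (sigma1_map a4_generic)"
  "\<exists>E Q. induced_action (d5_subst s2_map) E Q \<and> rel_a4 tends_to Q (sigma2_map a4_generic)"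
  "\<exists>E Q. induced_action (d5_subst s3_map) E Q \<and> rel_a4 tends_to Q (sigma3_map a4_generic)"
  "\<exists>E Q. induced_action (d5_subst s5_map) E Q \<and> rel_a4 tends_to Q (sigma4_map a4_generic)"
proof -
  obtain e x y z w t a0 a1 a2 a3 a4 b and A0 :: afield where
    point: "degeneration_point = DPt (e*x) (y/e) (e*z) (w/e) (b * (1 + 2*e*t))
      (a0 - a2 - a3 + b) a1 a2 a3 (- b) a4" and
    b: "2 * e^2 * b = 1" and
    gen: "a4_generic = APt (rvar VX) (rvar VY) (rvar VZ) (rvar VW) (rvar VT) A0
      (rvar VA1) (rvar VA2) (rvar VA3) (rvar VA4)" and
    lim: "tends_to x (- rvar VX)" "tends_to y (- rvar VY)" "tends_to z (- rvar VZ)"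
      "tends_to w (- rvar VW)" "tends_to t (rvar VT)" "tends_to a0 A0" "tends_to a1 (rvar VA1)"
      "tends_to a2 (rvar VA2)" "tends_to a3 (rvar VA3)" "tends_to a4 (rvar VA4)" and
    e: "tends_to e 0"
    by (rule degeneration_point_scaled)
  note P = degenerates_to_generic[unfolded point]
  note norm = normalized_d5_maps[OF normalized_d5_generic]
  have xz: "tends_to (x - z) (- rvar VX - - rvar VZ)"
    by (intro tends_to.arith lim)
  have nz: "y \<noteq> 0" "z \<noteq> 0" "w \<noteq> 0" "x - z \<noteq> 0"
    using lim(2-4)[THEN tends_to.nonzero] tends_to.nonzero[OF xz] a4_generic_denominators(2)
    by auto
  have e': "e \<noteq> 0" using b by auto
  have diff: "e*x - e*z = e*(x - z)"
    by (simp add: algebra_simps)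
  have zero: "tends_to (0 :: aseries) 0" by (rule tends_to.zero)
  show "\<exists>E Q. induced_action (d5_subst s1_map) E Q \<and> rel_a4 tends_to Q (sigma1_map a4_generic)"
    unfolding gen sigma1_map.simps
  proof (rule induced_action_limit[where \<kappa> = "0", OF _ e b])
    have "tends_to (x + a1/y) (- rvar VX + rvar VA1 / - rvar VY)"
      by (intro tends_to.arith lim) simp
    then show "tends_to (x + a1/y) (- (rvar VX + rvar VA1 / rvar VY))"
      by simp
    show "map_d5 (\<lambda>f. degeneration (d5_subst s1_map f)) d5_generic =
      DPt (e*(x + a1/y)) (y/e) (e*z) (w/e) (b * (1 + 2*e*t))
        ((a0 + a1) - (a2 + a1) - a3 + (b + 0)) (- a1) (a2 + a1) a3 (- (b + 0)) a4"
      using degenerates_to.rel_d5_maps(2)[OF P] nz e'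
      by (intro map_d5_degeneration_of[where m = s1_map] map_d5_subst_generic norm)
        (simp add: distrib_left mult.commute del: d5.rel_inject)
  qed (intro tends_to.arith lim)+
  show "\<exists>E Q. induced_action (d5_subst s2_map) E Q \<and> rel_a4 tends_to Q (sigma2_map a4_generic)"
    unfolding gen sigma2_map.simps
  proof (rule induced_action_limit[where \<kappa> = "0", OF _ e b])
    have "tends_to (y - a2/(x - z)) (- rvar VY - rvar VA2 / (- rvar VX - - rvar VZ))"
      "tends_to (w + a2/(x - z)) (- rvar VW + rvar VA2 / (- rvar VX - - rvar VZ))"
      using a4_generic_denominators(2) by (intro tends_to.arith lim; simp)+
    then show "tends_to (y - a2/(x - z)) (- (rvar VY - rvar VA2 / (rvar VX - rvar VZ)))"
      "tends_to (w + a2/(x - z)) (- (rvar VW + rvar VA2 / (rvar VX - rvar VZ)))"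
      unfolding minus_diff_minus divide_minus_right by simp_all
    have a0: "a0 - a2 - a3 + b + a2 = a0 - (- a2) - (a3 + a2) + (b + 0)"
      by simp
    show "map_d5 (\<lambda>f. degeneration (d5_subst s2_map f)) d5_generic =
      DPt (e*x) ((y - a2/(x - z))/e) (e*z) ((w + a2/(x - z))/e)
        (b * (1 + 2*e*t)) (a0 - (- a2) - (a3 + a2) + (b + 0)) (a1 + a2) (- a2) (a3 + a2)
        (- (b + 0)) a4"
      using degenerates_to.rel_d5_maps(3)[OF P] nz(4) e' unfolding s2_map.simps diff a0
      by (intro map_d5_degeneration_of[where m = s2_map] map_d5_subst_generic norm)
        (simp add: add_divide_distrib diff_divide_distrib mult.commute del: d5.rel_inject)
  qed (intro tends_to.arith lim)+
  show "\<exists>E Q. induced_action (d5_subst s3_map) E Q \<and> rel_a4 tends_to Q (sigma3_map a4_generic)"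
    unfolding gen sigma3_map.simps
  proof (rule induced_action_limit[where \<kappa> = "- rvar VA3", OF _ e b])
    have "tends_to (z + a3/w) (- rvar VZ + rvar VA3 / - rvar VW)"
      by (intro tends_to.arith lim) simp
    then show "tends_to (z + a3/w) (- (rvar VZ + rvar VA3 / rvar VW))"
      by simp
    have a0: "a0 - a2 - a3 + b = a0 - (a2 + a3) - (- a3) + (b + - a3)"
      by (simp add: algebra_simps)
    \<comment> \<open>\<open>s\<^sub>3\<close> adds \<open>\<alpha>\<^sub>3\<close> to \<open>\<alpha>\<^sub>4 = - b\<close>, hence \<open>k = - a3\<close>.\<close>
    show "map_d5 (\<lambda>f. degeneration (d5_subst s3_map f)) d5_generic =
      DPt (e*x) (y/e) (e*(z + a3/w)) (w/e) (b * (1 + 2*e*t))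
        (a0 - (a2 + a3) - (- a3) + (b + - a3)) a1 (a2 + a3) (- a3) (- (b + - a3)) (a4 + a3)"
      using degenerates_to.rel_d5_maps(4)[OF P] nz e' unfolding s3_map.simps a0
      by (intro map_d5_degeneration_of[where m = s3_map] map_d5_subst_generic norm)
        (simp add: distrib_left mult.commute del: d5.rel_inject)
  qed (intro tends_to.arith lim)+
  show "\<exists>E Q. induced_action (d5_subst s5_map) E Q \<and> rel_a4 tends_to Q (sigma4_map a4_generic)"
    unfolding gen sigma4_map.simps
  proof (rule induced_action_limit[where \<kappa> = "0", OF _ e b])
    have "tends_to (w - a4/z) (- rvar VW - rvar VA4 / - rvar VZ)"
      by (intro tends_to.arith lim) simp
    then show "tends_to (w - a4/z) (- (rvar VW - rvar VA4 / rvar VZ))"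
      by simp
    have a0: "a0 - a2 - a3 + b = (a0 + a4) - a2 - (a3 + a4) + (b + 0)"
      by simp
    show "map_d5 (\<lambda>f. degeneration (d5_subst s5_map f)) d5_generic =
      DPt (e*x) (y/e) (e*z) ((w - a4/z)/e) (b * (1 + 2*e*t))
        ((a0 + a4) - a2 - (a3 + a4) + (b + 0)) a1 a2 (a3 + a4) (- (b + 0)) (- a4)"
      using degenerates_to.rel_d5_maps(6)[OF P] nz e' unfolding s5_map.simps a0
      by (intro map_d5_degeneration_of[where m = s5_map] map_d5_subst_generic norm)
        (simp add: diff_divide_distrib mult.commute del: d5.rel_inject)
  qed (intro tends_to.arith lim)+
qed

text \<open>
As a palindrome of involutions the word is a conjugate of \<open>s\<^sub>3\<close>; it acts on the parameters as the reflection
in the root \<open>\<alpha>\<^sub>0 + \<alpha>\<^sub>2 + \<alpha>\<^sub>3 + \<alpha>\<^sub>4\<close>, in which the poles of \<open>\<alpha>\<^sub>0\<close> and \<open>\<alpha>\<^sub>4\<close> at \<open>\<epsilon> = 0\<close> cancel.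
\<close>

definition reflection :: "dfield \<Rightarrow> dfield" where
  "reflection = d5_subst s0_map \<circ> d5_subst s4_map \<circ> d5_subst s2_map \<circ> d5_subst s3_map \<circ>
     d5_subst s2_map \<circ> d5_subst s4_map \<circ> d5_subst s0_map"

lemma map_d5_reflection_generic:
  "map_d5 reflection d5_generic =
    s0_map (s4_map (s2_map (s3_map (s2_map (s4_map (s0_map d5_generic))))))"
proof -
  note norm = normalized_d5_maps[OF normalized_d5_generic]
  have "map_d5 reflection P = map_d5 (d5_subst s0_map) (map_d5 (d5_subst s4_map)
    (map_d5 (d5_subst s2_map) (map_d5 (d5_subst s3_map) (map_d5 (d5_subst s2_map)
    (map_d5 (d5_subst s4_map) (map_d5 (d5_subst s0_map) P))))))" for P
    by (simp add: reflection_def d5.map_comp comp_assoc)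
  then show ?thesis
    by (simp only: map_d5_subst_generic norm field_hom_d5_subst[THEN field_hom.map_d5_maps(1)]
        field_hom_d5_subst[THEN field_hom.map_d5_maps(2)]
        field_hom_d5_subst[THEN field_hom.map_d5_maps(3)]
        field_hom_d5_subst[THEN field_hom.map_d5_maps(4)]
        field_hom_d5_subst[THEN field_hom.map_d5_maps(5)])
qed

text \<open>
The limits of the auxiliary quantities are computed in the order of their definitions. The denominators
\<open>N, D, D1, N2\<close> all tend to \<open>1\<close>; the only non-trivial denominator in the limit is \<open>\<phi>/2\<close>, the limit of \<open>\<omega>\<close>, and it
is the source of the denominator \<open>\<phi>\<close> in \<open>\<sigma>\<^sub>0\<close>.
\<close>

lemma limit_reflection:
  "\<exists>E Q. induced_action reflection E Q \<and> rel_a4 tends_to Q (sigma0_map a4_generic)"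
proof -
  obtain e x y z w t a0 a1 a2 a3 a4 b and A0 :: afield where
    point: "degeneration_point = DPt (e*x) (y/e) (e*z) (w/e) (b * (1 + 2*e*t))
      (a0 - a2 - a3 + b) a1 a2 a3 (- b) a4" and
    b: "2 * e^2 * b = 1" and
    gen: "a4_generic = APt (rvar VX) (rvar VY) (rvar VZ) (rvar VW) (rvar VT) A0
      (rvar VA1) (rvar VA2) (rvar VA3) (rvar VA4)" and
    lim: "tends_to x (- rvar VX)" "tends_to y (- rvar VY)" "tends_to z (- rvar VZ)"
      "tends_to w (- rvar VW)" "tends_to t (rvar VT)" "tends_to a0 A0" "tends_to a1 (rvar VA1)"
      "tends_to a2 (rvar VA2)" "tends_to a3 (rvar VA3)" "tends_to a4 (rvar VA4)" and
    e: "tends_to e 0"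
    by (rule degeneration_point_scaled)
  define X Y Z W T where V: "X = rvar VX" "Y = rvar VY" "Z = rvar VZ" "W = rvar VW" "T = rvar VT"
  note lim' = lim[folded V] e
  define \<phi> where "\<phi> = X - 2*Y - 2*W + 2*T"
  have \<phi>: "\<phi> \<noteq> 0"
    using a4_generic_denominators(1) by (simp add: \<phi>_def V)
  define N where "N = 1 + 2*e*(t + y)"
  define x1 where "x1 = x + (2*e*(a0 - a2 - a3) - 2*(t + y)) / N"
  define D where "D = 1 + e*(x1 - z)"
  define \<omega> where "\<omega> = w + (2*e*(a0 - a3)*(1 - e*z) - x1) / (2*D*(1 - e*z))"
  define z1 where "z1 = z + a0/\<omega>"
  define D1 where "D1 = 1 + e*(x1 - z1)"
  define \<sigma> where "\<sigma> = (e*((a0 - a3)*D1 + a3*D) - a0/(2*\<omega>)) / (D*D1)"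
  define y2 where "y2 = y - \<sigma>"
  define N2 where "N2 = 1 + 2*e*(t + y2)"
  define x2 where "x2 = (x1*N2 + 2*(t + y2) + 2*e*(a2 + a3)) / N2"
  define w2 where "w2 = w + \<sigma> + a0 / (2*\<omega>*(1 - e*z)*(1 - e*z1)) + e*a0 / (1 - e*z1)"
  have unit: "tends_to (1 - e*h) 1" if "tends_to h H" for h :: aseries and H
    using tends_to.diff[OF tends_to.one tends_to.mult[OF e that]] by simp
  have unit': "tends_to (1 + e*h) 1" if "tends_to h H" for h :: aseries and H
    using tends_to.add[OF tends_to.one tends_to.mult[OF e that]] by simp
  have unit2: "tends_to (1 + 2*e*h) 1" if "tends_to h H" for h :: aseries and H
    using unit'[OF tends_to.mult[OF tends_to.numeral[of "num.Bit0 num.One"] that]]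
    by (simp add: mult_ac)
  have "tends_to N 1"
    unfolding N_def by (rule unit2[OF tends_to.add[OF lim'(5) lim'(2)]])
  note lim' = lim' this
  have "tends_to x1 (- X + (2*0*(A0 - rvar VA2 - rvar VA3) - 2*(T + - Y)) / 1)"
    unfolding x1_def by (intro tends_to.arith lim') simp
  then have lim_x1: "tends_to x1 (- X - 2*T + 2*Y)"
    by (simp add: algebra_simps)
  note lim' = lim' this
  have "tends_to D 1"
    unfolding D_def by (rule unit'[OF tends_to.diff[OF lim_x1 lim'(3)]])
  note lim' = lim' this unit[OF lim'(3)]
  have "tends_to \<omega> (- W + (2*0*(A0 - rvar VA3)*1 - (- X - 2*T + 2*Y)) / (2*1*1))"
    unfolding \<omega>_def by (intro tends_to.arith lim') simp
  also have "- W + (2*0*(A0 - rvar VA3)*1 - (- X - 2*T + 2*Y)) / (2*1*1) = \<phi> / 2"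
    by (simp add: \<phi>_def field_simps)
  finally have "tends_to \<omega> (\<phi> / 2)" .
  note lim' = lim' this
  have "tends_to z1 (- Z + A0 / (\<phi> / 2))"
    unfolding z1_def using \<phi> by (intro tends_to.arith lim') simp
  then have lim_z1: "tends_to z1 (- (Z - 2*A0/\<phi>))"
    by (simp add: mult.commute)
  note lim' = lim' this
  have "tends_to D1 1"
    unfolding D1_def by (rule unit'[OF tends_to.diff[OF lim_x1 lim_z1]])
  note lim' = lim' this unit[OF lim_z1]
  have "tends_to \<sigma> ((0*((A0 - rvar VA3)*1 + rvar VA3*1) - A0/(2*(\<phi> / 2))) / (1*1))"
    unfolding \<sigma>_def using \<phi> by (intro tends_to.arith lim'; simp)
  then have "tends_to \<sigma> (- (A0/\<phi>))"
    by simp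
  note lim' = lim' this
  have "tends_to y2 (- Y - - (A0/\<phi>))"
    unfolding y2_def by (intro tends_to.arith lim')
  then have lim_y2: "tends_to y2 (- (Y - A0/\<phi>))"
    by simp
  note lim' = lim' this
  have "tends_to N2 1"
    unfolding N2_def by (rule unit2[OF tends_to.add[OF lim'(5) lim_y2]])
  note lim' = lim' this
  have "tends_to x2 (((- X - 2*T + 2*Y)*1 + 2*(T + - (Y - A0/\<phi>)) + 2*0*(rvar VA2 + rvar VA3)) / 1)"
    unfolding x2_def by (intro tends_to.arith lim') simp
  then have "tends_to x2 (- (X - 2*A0/\<phi>))"
    by (simp add: algebra_simps)
  note lim' = lim' this
  have "tends_to w2 (- W + - (A0/\<phi>) + A0 / (2*(\<phi>/2)*1*1) + 0*A0/1)"
    unfolding w2_def using \<phi> by (intro tends_to.arith lim'; simp)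
  then have "tends_to w2 (- W)"
    by simp
  note lim' = lim' this
  have nz: "h \<noteq> 0" if "tends_to h H" "H \<noteq> 0" for h :: aseries and H
    using that by (rule tends_to.nonzero)
  have word: "rel_d5 degenerates_to (map_d5 reflection d5_generic)
    (DPt (e*x2) (y2/e) (e*z1) (w2/e) (b * (1 + 2*e*t))
      (b - a2 - a3) (a1 + a0) a2 a3 (- (b + a0)) (a4 + a0))"
    unfolding map_d5_reflection_generic
    by (rule degenerates_to.reflection_word[OF b degenerates_to_generic[unfolded point]
          N_def _ x1_def D_def _ _ \<omega>_def _ z1_def D1_def _ _ \<sigma>_def y2_def N2_def _ x2_def w2_def];
        rule nz, rule lim')
      (use \<phi> in simp_all)
  show ?thesis
    unfolding gen sigma0_map.simps V[symmetric] \<phi>_def[symmetric] Let_def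
  proof (rule induced_action_limit[where \<kappa> = "A0", OF _ e b])
    show "map_d5 (\<lambda>f. degeneration (reflection f)) d5_generic =
      DPt (e*x2) (y2/e) (e*z1) (w2/e) (b * (1 + 2*e*t))
      (- a0 - a2 - a3 + (b + a0)) (a1 + a0) a2 a3 (- (b + a0)) (a4 + a0)"
      using map_d5_degeneration[OF word] by simp
  qed (intro tends_to.arith lim')+
qed

theorem theorem2p4:
  shows "\<exists>H. subgroup H W_D5 \<and> converges_to H W_A4 sigmas"
proof -
  define S where "S = (!) [reflection, d5_subst s1_map, d5_subst s2_map, d5_subst s3_map,
    d5_subst s5_map]"
  have image: "S ` {..<length sigmas} = {reflection, d5_subst s1_map, d5_subst s2_map,
    d5_subst s3_map, d5_subst s5_map}"
    by (simp add: S_def sigmas_def lessThan_Suc insert_commute)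
  have "reflection \<in> carrier W_D5"
    unfolding reflection_def by (intro comp_in_W_D5) (use s_in_W_D5 in auto)
  then have "S ` {..<length sigmas} \<subseteq> carrier W_D5"
    unfolding image using s_in_W_D5 by auto
  then have "subgroup (generate W_D5 (S ` {..<length sigmas})) W_D5"
    by (rule group.generate_is_subgroup[OF W_D5_group])
  moreover have "converges_to (generate W_D5 (S ` {..<length sigmas})) W_A4 sigmas"
    unfolding converges_to_def
  proof (intro conjI exI[of _ S] refl allI impI)
    show "carrier W_A4 = generate W_A4 (set sigmas)"
      by (rule W_A4_generated)
    note norm = normalized_a4_maps[OF normalized_a4_generic]
    fix i assume "i < length sigmas"
    then have "i \<in> {0, 1, 2, 3, 4}"
      by (auto simp: sigmas_def)
    then show "\<exists>E Q. induced_action (S i) E Q \<and> rel_a4 tends_to Q (map_a4 (sigmas ! i) a4_generic)"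
      by (auto simp: S_def sigmas_def map_a4_subst_generic norm intro: limits_simple_reflections limit_reflection)
  qed
  ultimately show ?thesis by blast
qed

end
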